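(* Let $r>0$. The mean distance $M_1$ between two uniformly and independently distributed random points in the regular decagon $\mathcal{P}_{10,r}$ satisfies \begin{align*} \frac{M_1}{r}={}&\frac1{600}\Bigg[4\left(\sqrt{5125+2110\sqrt5}-24-11\sqrt5\right)-\left(505+239\sqrt5\right)\ln2\\ &-30\left(4+3\sqrt5\right)\ln5-\left(205+107\sqrt5\right)\ln\left(1+\sqrt5\right)\\ &+\left(705+343\sqrt5\right)\ln\left(3+\sqrt5\right)-\left(105+47\sqrt5\right)\ln\left(\sqrt5+\sqrt{10+2\sqrt5}\right)\\ &-\left(65-29\sqrt5\right)\ln\left(\sqrt5+\sqrt{10-2\sqrt5}\right)+\left(5+3\sqrt5\right)\ln\left(5-\sqrt5+2\sqrt{10-2\sqrt5}\right)\Bigg]. \end{align*}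
   Context: $\mathcal{P}_{n,r}$ is the (filled) regular polygon with $n$ sides whose circumscribed circle has radius $r$. The mean distance $M_1$ is the expected Euclidean distance between two points chosen independently and uniformly (w.r.t. area) from the polygon. *)

theory Defs
  imports "HOL-Probability.Probability"
begin

text \<open>The plane is modelled as \<^typ>\<open>complex\<close>; area is the Lebesgue measure \<^term>\<open>lborel\<close> on it.
  The circumcentre is placed at the origin and one vertex on the positive real axis.\<close>

definition regular_polygon :: "nat \<Rightarrow> real \<Rightarrow> complex set" where
  "regular_polygon n r =
     convex hull ((\<lambda>k. of_real r * cis (2 * pi * real k / real n)) ` {..<n})"

definition mean_distance :: "complex set \<Rightarrow> real" where
  "mean_distance K =
     (LINT z|(uniform_measure lborel K \<Otimes>\<^sub>M uniform_measure lborel K). dist (fst z) (snd z))"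

end

theory Submission
  imports Defs
begin

text \<open>
  A convex polygon with a point \<open>x\<close> of it splits into the triangles spanned by \<open>x\<close> and the edges. Since
  \<open>dist x y\<close> is homogeneous in \<open>y - x\<close>, the integral over \<open>y\<close> of \<open>dist x y\<close> becomes a third of the sum
  over the edges of an integral along the edge, weighted by the height of \<open>x\<close> over it. Doing the same
  for the integral over \<open>x\<close>, with the point on the edge as the new apex, reduces the mean distance to
  double integrals over pairs of edges. In the distances \<open>p\<close>, \<open>q\<close> from the intersection of the two
  supporting lines the integrand is \<open>p * q * sqrt (p\<^sup>2 + q\<^sup>2 + 2 * \<kappa> * p * q)\<close>, homogeneous of degree 3, so one
  more integration is trivial and the last one is elementary. In the decagon everything lies in the field
  generated by the golden ratio and \<open>sin (pi / 5)\<close>.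
\<close>

section \<open>Lebesgue measure on the complex plane\<close>

text \<open>For a function of degree m about the apex of a fan, the radial variable contributes the
  integral of \<open>\<tau> ^ (m + 1)\<close> over the unit interval, which is 1 / (m + 2). The
  distance has degree 1. In the second fan the factor \<open>height j x\<close> vanishes at the new
  apex on edge j, so the degree is 2; hence the constant 1/12. All of this is done with nonnegative
  integrals, so that exchanges and substitutions need no integrability, and degenerate apexes are
  discarded as null sets. By rotation five classes of edge pairs contribute. Sides k = 1, ..., 4
  steps apart lie on lines that meet, with \<open>\<kappa>\<close> = cos (k pi / 5); opposite sides
  are parallel and need a primitive of their own. The closed form exists because each square root
  left at the end is, up to scaling, a distance between two vertices, and the sides and diagonals of
  the decagon lie in the rational span of 1, \<open>\<phi>\<close>, \<open>S\<close> and
  \<open>\<phi> * S\<close>. What remains is to compare coefficients of ln 2, ln 5, ln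
  \<open>\<phi>\<close>, ln \<open>X1\<close> and ln \<open>X2\<close> in this basis.\<close>

lemma lborel_complex_eq_distr:
  "(lborel :: complex measure) = distr (lborel \<Otimes>\<^sub>M lborel) borel (\<lambda>(x, y). Complex x y)"
proof (rule lborel_eqI)
  have meas: "(\<lambda>(x, y). Complex x y) \<in> borel_measurable (lborel \<Otimes>\<^sub>M lborel)"
    by (subst borel_measurable_complex_iff) (auto simp: case_prod_unfold)
  fix l u :: complex
  assume *: "\<And>b. b \<in> Basis \<Longrightarrow> l \<bullet> b \<le> u \<bullet> b"
  have le: "Re l \<le> Re u" "Im l \<le> Im u"
    using *[of 1] *[of \<i>] by (auto simp: Basis_complex_def)
  have "(\<lambda>(x, y). Complex x y) -` box l u \<inter> space (lborel \<Otimes>\<^sub>M lborel)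
      = {Re l<..<Re u} \<times> {Im l<..<Im u}"
    by (auto simp: box_def Basis_complex_def space_pair_measure)
  then show "emeasure (distr (lborel \<Otimes>\<^sub>M lborel) borel (\<lambda>(x, y). Complex x y)) (box l u)
      = ennreal (\<Prod>b\<in>Basis. (u - l) \<bullet> b)"
    using le by (subst emeasure_distr[OF meas])
      (auto simp: lborel.emeasure_pair_measure_Times Basis_complex_def ennreal_mult)
qed auto

lemma nn_integral_lborel_complex:
  assumes [measurable]: "f \<in> borel_measurable (borel :: complex measure)"
  shows "(\<integral>\<^sup>+z. f z \<partial>lborel) = (\<integral>\<^sup>+x. \<integral>\<^sup>+y. f (Complex x y) \<partial>lborel \<partial>lborel)"
proof -
  have meas [measurable]: "(\<lambda>(x, y). Complex x y) \<in> borel_measurable (lborel \<Otimes>\<^sub>M lborel)"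
    by (subst borel_measurable_complex_iff) (auto simp: case_prod_unfold)
  show ?thesis
    by (subst lborel_complex_eq_distr, subst nn_integral_distr)
       (auto simp: lborel.nn_integral_fst[symmetric] case_prod_unfold intro!: measurable_compose[OF meas[unfolded case_prod_unfold]])
qed

lemma nn_integral_lborel_swap:
  fixes f :: "'a::euclidean_space \<Rightarrow> 'b::euclidean_space \<Rightarrow> ennreal"
  assumes "(\<lambda>(x, y). f x y) \<in> borel_measurable borel"
  shows "(\<integral>\<^sup>+x. \<integral>\<^sup>+y. f x y \<partial>lborel \<partial>lborel) = (\<integral>\<^sup>+y. \<integral>\<^sup>+x. f x y \<partial>lborel \<partial>lborel)"
proof -
  have "(\<lambda>(x, y). f x y) \<in> borel_measurable (lborel \<Otimes>\<^sub>M lborel)"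
    using assms by (simp add: lborel_prod)
  from lborel_pair.Fubini[OF this] show ?thesis by simp
qed

lemma measurable_Complex [measurable]:
  assumes [measurable]: "f \<in> borel_measurable M" "g \<in> borel_measurable M"
  shows "(\<lambda>x. Complex (f x) (g x)) \<in> borel_measurable M"
  by (subst borel_measurable_complex_iff) auto

text \<open>\<open>Im (cnj a * b)\<close> is the determinant of \<open>a\<close> and
  \<open>b\<close>. The change of variables is done as two one-dimensional substitutions,
  \<open>y\<close> at fixed \<open>x\<close> and then \<open>x\<close> at fixed \<open>v\<close>.
  This needs \<open>Re a \<noteq> 0\<close>; otherwise \<open>Re b \<noteq> 0\<close> and the roles
  of \<open>a\<close> and \<open>b\<close> are exchanged.\<close>

lemma nn_integral_lborel_complex_affine:
  fixes a b c :: complex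
  assumes [measurable]: "f \<in> borel_measurable borel" and det: "Im (cnj a * b) \<noteq> 0"
  shows "(\<integral>\<^sup>+z. f z \<partial>lborel)
    = ennreal \<bar>Im (cnj a * b)\<bar> * (\<integral>\<^sup>+u. \<integral>\<^sup>+v. f (c + of_real u * a + of_real v * b) \<partial>lborel \<partial>lborel)"
proof -
  have key: "(\<integral>\<^sup>+z. f z \<partial>lborel)
    = ennreal \<bar>Im (cnj a * b)\<bar> * (\<integral>\<^sup>+u. \<integral>\<^sup>+v. f (c + of_real u * a + of_real v * b) \<partial>lborel \<partial>lborel)"
    if det: "Im (cnj a * b) \<noteq> 0" and a: "Re a \<noteq> 0" for a b
  proof -
    define d where "d = Im (cnj a * b) / Re a"
    have d: "d \<noteq> 0" using det a by (simp add: d_def)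
    have "(\<integral>\<^sup>+z. f z \<partial>lborel) = (\<integral>\<^sup>+x. \<integral>\<^sup>+y. f (Complex x y) \<partial>lborel \<partial>lborel)"
      by (rule nn_integral_lborel_complex) simp
    \<comment> \<open>With the slope \<open>Im a / Re a\<close> the point moves in direction
      \<open>a\<close> when \<open>x\<close> varies at fixed \<open>v\<close>; \<open>d\<close> is
      chosen so that \<open>d * Re a\<close> is the determinant.\<close>
    also have "\<dots> = (\<integral>\<^sup>+x. ennreal \<bar>d\<bar> * (\<integral>\<^sup>+v. f (Complex x (Im c + Im a / Re a * (x - Re c) + d * v)) \<partial>lborel) \<partial>lborel)"
      by (intro nn_integral_cong nn_integral_real_affine d) simp
    also have "\<dots> = ennreal \<bar>d\<bar> * (\<integral>\<^sup>+x. \<integral>\<^sup>+v. f (Complex x (Im c + Im a / Re a * (x - Re c) + d * v)) \<partial>lborel \<partial>lborel)"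
      by (rule nn_integral_cmult) simp
    also have "(\<integral>\<^sup>+x. \<integral>\<^sup>+v. f (Complex x (Im c + Im a / Re a * (x - Re c) + d * v)) \<partial>lborel \<partial>lborel)
       = (\<integral>\<^sup>+v. \<integral>\<^sup>+x. f (Complex x (Im c + Im a / Re a * (x - Re c) + d * v)) \<partial>lborel \<partial>lborel)"
      by (rule nn_integral_lborel_swap) (simp add: borel_prod[symmetric] case_prod_unfold)
    also have "\<dots> = (\<integral>\<^sup>+v. ennreal \<bar>Re a\<bar> * (\<integral>\<^sup>+u. f (c + of_real u * a + of_real v * b) \<partial>lborel) \<partial>lborel)"
    proof (rule nn_integral_cong)
      fix v :: real
      have "Complex (Re c + v * Re b + Re a * u) (Im c + Im a / Re a * ((Re c + v * Re b + Re a * u) - Re c) + d * v)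
          = c + of_real u * a + of_real v * b" for u
        using a by (simp add: complex_eq_iff d_def field_simps)
      then show "(\<integral>\<^sup>+x. f (Complex x (Im c + Im a / Re a * (x - Re c) + d * v)) \<partial>lborel)
          = ennreal \<bar>Re a\<bar> * (\<integral>\<^sup>+u. f (c + of_real u * a + of_real v * b) \<partial>lborel)"
        by (subst nn_integral_real_affine[OF _ a, where t = "Re c + v * Re b"]) simp_all
    qed
    also have "\<dots> = ennreal \<bar>Re a\<bar> * (\<integral>\<^sup>+v. \<integral>\<^sup>+u. f (c + of_real u * a + of_real v * b) \<partial>lborel \<partial>lborel)"
      by (rule nn_integral_cmult) simp
    also have "(\<integral>\<^sup>+v. \<integral>\<^sup>+u. f (c + of_real u * a + of_real v * b) \<partial>lborel \<partial>lborel)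
        = (\<integral>\<^sup>+u. \<integral>\<^sup>+v. f (c + of_real u * a + of_real v * b) \<partial>lborel \<partial>lborel)"
      by (rule nn_integral_lborel_swap) (simp add: borel_prod[symmetric] case_prod_unfold)
    also have "ennreal \<bar>d\<bar> * (ennreal \<bar>Re a\<bar> * X) = ennreal \<bar>Im (cnj a * b)\<bar> * X" for X
    proof -
      have "\<bar>Im (cnj a * b)\<bar> = \<bar>d\<bar> * \<bar>Re a\<bar>" using a unfolding d_def abs_mult[symmetric] by simp
      then show ?thesis by (simp add: ennreal_mult mult.assoc)
    qed
    finally show ?thesis .
  qed
  show ?thesis
  proof (cases "Re a = 0")
    case False then show ?thesis using key det by blast
  next
    case True
    then have b: "Re b \<noteq> 0" and det': "Im (cnj b * a) = - Im (cnj a * b)" using det by auto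
    have "(\<integral>\<^sup>+u. \<integral>\<^sup>+v. f (c + of_real u * b + of_real v * a) \<partial>lborel \<partial>lborel)
      = (\<integral>\<^sup>+v. \<integral>\<^sup>+u. f (c + of_real u * b + of_real v * a) \<partial>lborel \<partial>lborel)"
      by (rule nn_integral_lborel_swap) (simp add: borel_prod[symmetric] case_prod_unfold)
    then show ?thesis using key[of b a] b det unfolding det' abs_minus_cancel
      by (simp add: add.assoc add.left_commute add.commute[of "_ * b" "_ * a"])
  qed
qed

text \<open>The coordinate \<open>\<tau> = u + v\<close> tells how far the point has moved from
  \<open>x\<close> towards the opposite side, and \<open>t = v / \<tau>\<close> is the position
  along that side. The Jacobian is \<open>\<tau>\<close>.\<close>

lemma nn_integral_lborel_triangle:
  fixes x a b :: complex
  assumes [measurable]: "f \<in> borel_measurable borel"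
  shows "(\<integral>\<^sup>+u. \<integral>\<^sup>+v. (if 0 \<le> u \<and> 0 \<le> v \<and> u + v \<le> 1 then f (x + of_real u * (a - x) + of_real v * (b - x)) else 0) \<partial>lborel \<partial>lborel)
    = (\<integral>\<^sup>+\<tau>\<in>{0..1}. (\<integral>\<^sup>+t\<in>{0..1}. ennreal \<tau> * f (x + of_real \<tau> * (of_real (1 - t) * a + of_real t * b - x)) \<partial>lborel) \<partial>lborel)"
    (is "?L = ?R")
proof -
  define g where "g u v = (if 0 \<le> u \<and> 0 \<le> v \<and> u + v \<le> 1 then f (x + of_real u * (a - x) + of_real v * (b - x)) else 0)" for u v :: real
  have g [measurable]: "(\<lambda>(u, v). g u v) \<in> borel_measurable (borel \<Otimes>\<^sub>M borel)"
    unfolding g_def by simp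
  have g2 [measurable]: "(\<lambda>z. g (h1 z) (h2 z)) \<in> borel_measurable M"
    if [measurable]: "h1 \<in> borel_measurable M" "h2 \<in> borel_measurable M" for h1 h2 and M :: "'z measure"
    unfolding g_def by simp
  have "?L = (\<integral>\<^sup>+u. \<integral>\<^sup>+v. g u v \<partial>lborel \<partial>lborel)" by (simp add: g_def)
  also have "\<dots> = (\<integral>\<^sup>+v. \<integral>\<^sup>+u. g u v \<partial>lborel \<partial>lborel)"
    by (rule nn_integral_lborel_swap) (use g in \<open>simp add: borel_prod\<close>)
  also have "\<dots> = (\<integral>\<^sup>+v. \<integral>\<^sup>+\<tau>. g (\<tau> - v) v \<partial>lborel \<partial>lborel)"
  proof (rule nn_integral_cong)
    fix v :: real
    show "(\<integral>\<^sup>+u. g u v \<partial>lborel) = (\<integral>\<^sup>+\<tau>. g (\<tau> - v) v \<partial>lborel)"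
      using nn_integral_real_affine[of "\<lambda>u. g u v" 1 "- v"] by simp
  qed
  also have "\<dots> = (\<integral>\<^sup>+\<tau>. \<integral>\<^sup>+v. g (\<tau> - v) v \<partial>lborel \<partial>lborel)"
    by (rule nn_integral_lborel_swap) (simp add: borel_prod[symmetric] case_prod_unfold)
  also have "\<dots> = ?R"
  proof (rule nn_integral_cong_AE)
    have "AE \<tau> in lborel. \<tau> \<noteq> (0::real)" by (rule AE_lborel_singleton)
    then show "AE \<tau> in lborel. (\<integral>\<^sup>+v. g (\<tau> - v) v \<partial>lborel) = 
      (\<integral>\<^sup>+t\<in>{0..1}. ennreal \<tau> * f (x + of_real \<tau> * (of_real (1 - t) * a + of_real t * b - x)) \<partial>lborel) * indicator {0..1} \<tau>"
    proof eventually_elim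
      case (elim \<tau>)
      show ?case
      proof (cases "0 < \<tau> \<and> \<tau> \<le> 1")
        case False
        then have "g (\<tau> - v) v = 0" for v using elim by (auto simp: g_def)
        then show ?thesis using False elim by (auto simp: indicator_def)
      next
        case True
        have "(\<integral>\<^sup>+v. g (\<tau> - v) v \<partial>lborel) = ennreal \<bar>\<tau>\<bar> * (\<integral>\<^sup>+t. g (\<tau> - (0 + \<tau> * t)) (0 + \<tau> * t) \<partial>lborel)"
          by (rule nn_integral_real_affine) (use elim in auto)
        also have "\<dots> = (\<integral>\<^sup>+t. ennreal \<bar>\<tau>\<bar> * g (\<tau> - (0 + \<tau> * t)) (0 + \<tau> * t) \<partial>lborel)"
          by (rule nn_integral_cmult[symmetric]) simp
        also have "\<dots> = (\<integral>\<^sup>+t\<in>{0..1}. ennreal \<tau> * f (x + of_real \<tau> * (of_real (1 - t) * a + of_real t * b - x)) \<partial>lborel)"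
        proof (rule nn_integral_cong)
          fix t :: real
          have *: "0 \<le> \<tau> - \<tau> * t \<longleftrightarrow> t \<le> 1" "0 \<le> \<tau> * t \<longleftrightarrow> 0 \<le> t"
            using True by (auto simp: zero_le_mult_iff mult_le_cancel_left1)
          have eq: "x + of_real (\<tau> - \<tau> * t) * (a - x) + of_real (\<tau> * t) * (b - x)
              = x + of_real \<tau> * (of_real (1 - t) * a + of_real t * b - x)"
            by (simp add: algebra_simps)
          from * show "ennreal \<bar>\<tau>\<bar> * g (\<tau> - (0 + \<tau> * t)) (0 + \<tau> * t)
              = ennreal \<tau> * f (x + of_real \<tau> * (of_real (1 - t) * a + of_real t * b - x)) * indicator {0..1} t"
            using True by (auto simp: g_def indicator_def eq simp del: of_real_diff of_real_mult)
        qed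
        finally show ?thesis using True by (simp add: indicator_def)
      qed
    qed
  qed
  finally show ?thesis .
qed

section \<open>Fan triangulations of convex polygons\<close>

text \<open>The zero set is a line, unless \<open>w = 0\<close>; then the witness \<open>p\<close>
  shows that the constant is nonzero and the set is empty.\<close>

lemma null_set_affine_complex:
  fixes g :: "complex \<Rightarrow> real"
  assumes g: "\<And>z. g z = c + w \<bullet> z" and ne: "g p \<noteq> 0"
  shows "{z. g z = 0} \<in> null_sets lborel"
proof (cases "w = 0")
  case True
  then show ?thesis using g ne by auto
next
  case False
  have "{z. g z = 0} = {z. w \<bullet> z = - c}" by (auto simp: g)
  moreover have "{z. w \<bullet> z = - c} \<in> null_sets lebesgue"
    using negligible_hyperplane[of w "- c"] False by (simp add: negligible_iff_null_sets)
  moreover have "{z. w \<bullet> z = - c} \<in> sets borel" by measurable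
  ultimately show ?thesis by (auto simp: null_sets_completion_iff)
qed

text \<open>The last assumption includes counterclockwise orientation: every vertex not on edge
  \<open>i\<close> lies strictly to its left. Indices run over all naturals with period
  \<open>n\<close>, so that \<open>Suc i\<close> is the next vertex without reduction.\<close>

locale convex_polygon =
  fixes n :: nat and V :: "nat \<Rightarrow> complex"
  assumes three_le: "3 \<le> n"
    and vertex_periodic: "V (i + n) = V i"
    and strictly_convex: "\<lbrakk>i < n; j < n; j \<noteq> i; j \<noteq> Suc i mod n\<rbrakk>
      \<Longrightarrow> 0 < Im (cnj (V i - V j) * (V (Suc i) - V j))"
begin

text \<open>Twice the signed area of the triangle \<open>z\<close>, \<open>V i\<close>,
  \<open>V (Suc i)\<close>: the signed distance to the edge line times the length of the edge. In
  this scaling it is the determinant of the fan triangle with apex \<open>z\<close>.\<close>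

definition height :: "nat \<Rightarrow> complex \<Rightarrow> real" where
  "height i z = Im (cnj (V i - z) * (V (Suc i) - z))"

definition edge :: "nat \<Rightarrow> real \<Rightarrow> complex" where
  "edge i t = of_real (1 - t) * V i + of_real t * V (Suc i)"

definition region :: "complex set" where
  "region = {z. \<forall>i<n. 0 \<le> height i z}"

lemma vertex_mod: "V (i mod n) = V i"
proof -
  have "V (a + k * n) = V a" for a k
  proof (induction k)
    case (Suc k)
    then show ?case using vertex_periodic[of "a + k * n"] by (simp add: algebra_simps)
  qed simp
  from this[of "i mod n" "i div n"] show ?thesis by simp
qed

lemma vertex_cong: "i mod n = j mod n \<Longrightarrow> V i = V j"
  by (metis vertex_mod)

lemma height_cong: "i mod n = j mod n \<Longrightarrow> height i z = height j z"
  unfolding height_def using vertex_cong[of i j] vertex_cong[of "Suc i" "Suc j"]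
  by (simp add: mod_Suc_eq[symmetric, of i] mod_Suc_eq[symmetric, of j])

text \<open>The quadratic term is \<open>Im (cnj z * z) = 0\<close>, so the height is affine in
  \<open>z\<close>.\<close>

lemma height_eq_inner:
  "height i z = Im (cnj (V i) * V (Suc i))
    + Complex (Im (V i - V (Suc i))) (- Re (V i - V (Suc i))) \<bullet> z"
  by (simp add: height_def inner_complex_def algebra_simps)

lemma height_affine:
  "height i (x + of_real u * (a - x) + of_real v * (b - x))
    = (1 - u - v) * height i x + u * height i a + v * height i b"
  by (simp add: height_eq_inner inner_complex_def algebra_simps)

lemma height_measurable [measurable]: "height i \<in> borel_measurable borel"
  unfolding height_eq_inner[abs_def] by measurable

lemma edge_measurable [measurable]: "edge i \<in> borel_measurable borel"
  unfolding edge_def[abs_def] by measurable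

lemma region_measurable [measurable]: "region \<in> sets borel"
  unfolding region_def by measurable

lemma height_vertex_self [simp]: "height i (V i) = 0"
  by (simp add: height_def)

lemma height_vertex_Suc [simp]: "height i (V (Suc i)) = 0"
  by (simp add: height_def)

lemma height_vertex_pos:
  assumes "j mod n \<noteq> i mod n" "j mod n \<noteq> Suc i mod n"
  shows "0 < height i (V j)"
proof -
  have "0 < height (i mod n) (V (j mod n))"
    unfolding height_def by (rule strictly_convex) (use assms three_le in \<open>auto simp: mod_Suc_eq\<close>)
  then show ?thesis using height_cong[of "i mod n" i] by (simp add: vertex_mod)
qed

lemma height_vertex_nonneg: "0 \<le> height i (V j)"
proof (cases "j mod n = i mod n \<or> j mod n = Suc i mod n")
  case True
  then have "V j = V i \<or> V j = V (Suc i)" using vertex_cong by blast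
  then show ?thesis by auto
qed (use height_vertex_pos[of j i] in auto)

lemma mod_Suc_neq: "Suc i mod n \<noteq> i mod n" "Suc (Suc i) mod n \<noteq> i mod n"
proof -
  show "Suc i mod n \<noteq> i mod n" using three_le by (simp add: mod_Suc)
  show "Suc (Suc i) mod n \<noteq> i mod n" using three_le by (auto simp: mod_Suc split: if_splits)
qed

lemma height_vertex_next: "0 < height i (V (Suc (Suc i)))"
  by (rule height_vertex_pos) (use mod_Suc_neq in auto)

lemma height_vertex_prev: "0 < height (Suc i) (V i)"
  by (rule height_vertex_pos) (use mod_Suc_neq[of i] in auto)

lemma height_nonneg: "z \<in> region \<Longrightarrow> 0 \<le> height i z"
  using height_cong[of "i mod n" i z] three_le mod_less_divisor[of n i] by (auto simp: region_def simp del: mod_less_divisor)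

text \<open>\<open>1 - u - v\<close> is the ratio \<open>height i z / height i x\<close>, so
  \<open>u + v \<le> 1\<close> says that \<open>z\<close> is on the inner side of edge
  \<open>i\<close>. Each adjacent edge contains one endpoint of edge \<open>i\<close>, so comparing
  with its ratio isolates the sign of \<open>u\<close> or of \<open>v\<close>. The comparison is
  cross-multiplied because \<open>height j x\<close> may be 0.\<close>

lemma region_triangle_iff:
  assumes i: "i < n" and x: "x \<in> region" and pos: "0 < height i x"
    and z: "z = x + of_real u * (V i - x) + of_real v * (V (Suc i) - x)"
  shows "z \<in> region \<and> (\<forall>j<n. height i z * height j x \<le> height j z * height i x)
    \<longleftrightarrow> 0 \<le> u \<and> 0 \<le> v \<and> u + v \<le> 1"
proof
  have hz: "height j z = (1 - u - v) * height j x + u * height j (V i) + v * height j (V (Suc i))" for j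
    unfolding z by (rule height_affine)
  {
    assume uv: "0 \<le> u \<and> 0 \<le> v \<and> u + v \<le> 1"
    have le: "(1 - u - v) * height j x \<le> height j z" for j
      using uv by (simp add: hz height_vertex_nonneg)
    have "0 \<le> height j z" for j
      using le[of j] height_nonneg[OF x, of j] uv by (smt (verit) mult_nonneg_nonneg)
    moreover have "height i z * height j x \<le> height j z * height i x" for j
    proof -
      have "height i z * height j x = ((1 - u - v) * height j x) * height i x"
        by (simp add: hz)
      also have "\<dots> \<le> height j z * height i x"
        using le pos by (intro mult_right_mono) auto
      finally show ?thesis .
    qed
    ultimately show "z \<in> region \<and> (\<forall>j<n. height i z * height j x \<le> height j z * height i x)"
      by (auto simp: region_def)
  }
  {
    assume *: "z \<in> region \<and> (\<forall>j<n. height i z * height j x \<le> height j z * height i x)"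
    have all: "height i z * height j x \<le> height j z * height i x" for j
      using * three_le height_cong[of "j mod n" j] by (metis mod_mod_trivial mod_less_divisor less_le_trans zero_less_numeral)
    have "0 \<le> (1 - u - v) * height i x"
      using height_nonneg[of z i] * by (simp add: hz)
    then have "u + v \<le> 1" using pos by (simp add: zero_le_mult_iff)
    moreover have "0 \<le> u * height (Suc i) (V i) * height i x"
      using all[of "Suc i"] by (simp add: hz algebra_simps)
    then have "0 \<le> u" using pos height_vertex_prev[of i] by (simp add: zero_le_mult_iff)
    moreover have "0 \<le> v"
    proof -
      \<comment> \<open>The predecessor of \<open>i\<close>, written this way because
        \<open>i\<close> may be 0. It passes through \<open>V i\<close>, so the term with
        \<open>u\<close> drops out.\<close>
      define k where "k = i + n - 1"
      have k: "Suc k = i + n" using three_le by (simp add: k_def)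
      then have "V (Suc k) = V i" "V (Suc (Suc k)) = V (Suc i)"
        using vertex_periodic[of i] vertex_periodic[of "Suc i"] by auto
      then have "height k (V i) = 0" "0 < height k (V (Suc i))"
        using height_vertex_Suc[of k] height_vertex_next[of k] by auto
      moreover from this have "0 \<le> v * height k (V (Suc i)) * height i x"
        using all[of k] by (simp add: hz algebra_simps)
      ultimately show ?thesis using pos by (simp add: zero_le_mult_iff)
    qed
    ultimately show "0 \<le> u \<and> 0 \<le> v \<and> u + v \<le> 1" by simp
  }
qed

text \<open>The difference is affine in \<open>z\<close> and nonzero at an endpoint of edge
  \<open>i\<close> off the line of edge \<open>j\<close>. Such an endpoint exists since different
  edges share at most one vertex.\<close>

lemma null_set_height_ratio:
  assumes ij: "i < n" "j < n" "i \<noteq> j" and "0 < height i x" "0 < height j x"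
  shows "{z. height i z * height j x - height j z * height i x = 0} \<in> null_sets lborel"
proof -
  let ?c = "\<lambda>k. Im (cnj (V k) * V (Suc k))"
  let ?w = "\<lambda>k. Complex (Im (V k - V (Suc k))) (- Re (V k - V (Suc k)))"
  obtain p where p: "p = V i \<or> p = V (Suc i)" "0 < height j p"
  proof (cases "i mod n = Suc j mod n")
    case False
    then show ?thesis using that[of "V i"] height_vertex_pos[of i j] ij by simp
  next
    case True
    then have "Suc i mod n = Suc (Suc j) mod n" by (metis mod_Suc_eq)
    then have "0 < height j (V (Suc i))" using vertex_cong height_vertex_next[of j] by metis
    then show ?thesis using that by blast
  qed
  show ?thesis
  proof (rule null_set_affine_complex)
    show "height i z * height j x - height j z * height i x
      = (?c i * height j x - ?c j * height i x) + (height j x *\<^sub>R ?w i - height i x *\<^sub>R ?w j) \<bullet> z" for z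
      by (simp add: height_eq_inner[of _ z] algebra_simps inner_complex_def)
    show "height i p * height j x - height j p * height i x \<noteq> 0"
      using p assms by auto
  qed
qed

text \<open>The fan triangle over edge \<open>i\<close> with apex \<open>x\<close> consists of those points of the polygon at
  which the ratio \<open>height i z / height i x\<close> is minimal among all edges.\<close>

lemma nn_integral_region_fan:
  assumes [measurable]: "f \<in> borel_measurable borel"
    and x: "x \<in> region"
    and not_vertex: "\<And>i j. \<lbrakk>i < n; j < n; height i x = 0; height j x = 0\<rbrakk> \<Longrightarrow> i = j"
  shows "(\<integral>\<^sup>+z\<in>region. f z \<partial>lborel) = (\<Sum>i<n. ennreal (height i x) *
    (\<integral>\<^sup>+\<tau>\<in>{0..1}. (\<integral>\<^sup>+t\<in>{0..1}. ennreal \<tau> * f (x + of_real \<tau> * (edge i t - x)) \<partial>lborel) \<partial>lborel))"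
proof -
  \<comment> \<open>Only edges whose line misses \<open>x\<close> span a genuine triangle. The
    others have coefficient 0 and are put back into the sum at the end.\<close>
  define P where "P = {i. i < n \<and> 0 < height i x}"
  have fin: "finite P" by (simp add: P_def)
  have hx: "0 \<le> height i x" for i by (rule height_nonneg[OF x])
  define T where "T i = {z \<in> region. \<forall>j<n. height i z * height j x \<le> height j z * height i x}" for i
  have [measurable]: "T i \<in> sets borel" for i unfolding T_def by measurable
  have "P \<noteq> {}"
  proof
    assume "P = {}"
    then have "height i x = 0" if "i < n" for i
      using that hx[of i] by (force simp: P_def)
    from this[of 0] this[of 1] show False using not_vertex[of 0 1] three_le by auto
  qed
  have cover: "\<exists>i\<in>P. z \<in> T i" if z: "z \<in> region" for z
  proof -
    obtain i where i: "i \<in> P" and min: "\<And>j. j \<in> P \<Longrightarrow> height i z / height i x \<le> height j z / height j x"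
      using ex_min_if_finite[of "(\<lambda>j. height j z / height j x) ` P"] fin \<open>P \<noteq> {}\<close>
      by (auto simp: not_less)
    have "height i z * height j x \<le> height j z * height i x" if "j < n" for j
    proof (cases "j \<in> P")
      case True
      then show ?thesis using min[of j] i by (simp add: P_def field_simps)
    next
      case False
      then have "height j x = 0" using hx[of j] that by (auto simp: P_def)
      then show ?thesis using height_nonneg[OF z, of j] hx[of i] by simp
    qed
    then show ?thesis using i z by (auto simp: T_def)
  qed
  \<comment> \<open>Two fan triangles meet only where their ratios agree, which is a null
    set.\<close>
  have "AE z in lborel. \<forall>i\<in>P. \<forall>j\<in>P. i \<noteq> j \<longrightarrow> height i z * height j x - height j z * height i x \<noteq> 0"
  proof (intro AE_finite_allI fin)
    fix i j assume "i \<in> P" "j \<in> P"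
    then have "{z. height i z * height j x - height j z * height i x = 0} \<in> null_sets lborel" if "i \<noteq> j"
      using that by (intro null_set_height_ratio) (auto simp: P_def)
    from AE_not_in[OF this] show "AE z in lborel. i \<noteq> j \<longrightarrow> height i z * height j x - height j z * height i x \<noteq> 0"
      by (cases "i = j") auto
  qed
  then have "AE z in lborel. f z * indicator region z = (\<Sum>i\<in>P. f z * indicator (T i) z)"
  proof eventually_elim
    case (elim z)
    show ?case
    proof (cases "z \<in> region")
      case True
      then obtain i where i: "i \<in> P" "z \<in> T i" using cover by blast
      have "z \<notin> T j" if "j \<in> P" "j \<noteq> i" for j
      proof
        assume "z \<in> T j"
        then have "height i z * height j x = height j z * height i x"
          using i that by (intro antisym) (auto simp: T_def P_def)
        with elim i that show False by auto
      qed
      then have "(\<Sum>i\<in>P. f z * indicator (T i) z) = (\<Sum>j\<in>{i}. f z * indicator (T j) z)"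
        using i fin by (intro sum.mono_neutral_right) (auto simp: indicator_def)
      then show ?thesis using True i by simp
    next
      case False
      then show ?thesis by (simp add: T_def)
    qed
  qed
  then have "(\<integral>\<^sup>+z\<in>region. f z \<partial>lborel) = (\<integral>\<^sup>+z. (\<Sum>i\<in>P. f z * indicator (T i) z) \<partial>lborel)"
    by (rule nn_integral_cong_AE)
  also have "\<dots> = (\<Sum>i\<in>P. \<integral>\<^sup>+z. f z * indicator (T i) z \<partial>lborel)"
    by (rule nn_integral_sum) simp
  also have "\<dots> = (\<Sum>i\<in>P. ennreal (height i x) *
    (\<integral>\<^sup>+\<tau>\<in>{0..1}. (\<integral>\<^sup>+t\<in>{0..1}. ennreal \<tau> * f (x + of_real \<tau> * (edge i t - x)) \<partial>lborel) \<partial>lborel))"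
  proof (rule sum.cong[OF refl])
    fix i assume "i \<in> P"
    then have i: "i < n" "0 < height i x" by (auto simp: P_def)
    have det: "Im (cnj (V i - x) * (V (Suc i) - x)) = height i x" by (simp add: height_def)
    have "(\<integral>\<^sup>+z. f z * indicator (T i) z \<partial>lborel) = ennreal (height i x) *
      (\<integral>\<^sup>+u. \<integral>\<^sup>+v. f (x + of_real u * (V i - x) + of_real v * (V (Suc i) - x)) *
        indicator (T i) (x + of_real u * (V i - x) + of_real v * (V (Suc i) - x)) \<partial>lborel \<partial>lborel)"
      using nn_integral_lborel_complex_affine[of "\<lambda>z. f z * indicator (T i) z" "V i - x" "V (Suc i) - x" x] i
      unfolding det by simp
    also have "(\<integral>\<^sup>+u. \<integral>\<^sup>+v. f (x + of_real u * (V i - x) + of_real v * (V (Suc i) - x)) *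
        indicator (T i) (x + of_real u * (V i - x) + of_real v * (V (Suc i) - x)) \<partial>lborel \<partial>lborel)
      = (\<integral>\<^sup>+u. \<integral>\<^sup>+v. (if 0 \<le> u \<and> 0 \<le> v \<and> u + v \<le> 1 then f (x + of_real u * (V i - x) + of_real v * (V (Suc i) - x)) else 0) \<partial>lborel \<partial>lborel)"
    proof (intro nn_integral_cong)
      fix u v :: real
      have "x + of_real u * (V i - x) + of_real v * (V (Suc i) - x) \<in> T i \<longleftrightarrow> 0 \<le> u \<and> 0 \<le> v \<and> u + v \<le> 1"
        using region_triangle_iff[OF i(1) x i(2) refl, of u v] by (simp add: T_def)
      then show "f (x + of_real u * (V i - x) + of_real v * (V (Suc i) - x)) *
        indicator (T i) (x + of_real u * (V i - x) + of_real v * (V (Suc i) - x))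
        = (if 0 \<le> u \<and> 0 \<le> v \<and> u + v \<le> 1 then f (x + of_real u * (V i - x) + of_real v * (V (Suc i) - x)) else 0)"
        by (simp only: indicator_def) simp
    qed
    also have "\<dots> = (\<integral>\<^sup>+\<tau>\<in>{0..1}. (\<integral>\<^sup>+t\<in>{0..1}. ennreal \<tau> * f (x + of_real \<tau> * (edge i t - x)) \<partial>lborel) \<partial>lborel)"
      unfolding edge_def by (rule nn_integral_lborel_triangle) simp
    finally show "(\<integral>\<^sup>+z. f z * indicator (T i) z \<partial>lborel) = ennreal (height i x) *
      (\<integral>\<^sup>+\<tau>\<in>{0..1}. (\<integral>\<^sup>+t\<in>{0..1}. ennreal \<tau> * f (x + of_real \<tau> * (edge i t - x)) \<partial>lborel) \<partial>lborel)" .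
  qed
  also have "\<dots> = (\<Sum>i<n. ennreal (height i x) *
    (\<integral>\<^sup>+\<tau>\<in>{0..1}. (\<integral>\<^sup>+t\<in>{0..1}. ennreal \<tau> * f (x + of_real \<tau> * (edge i t - x)) \<partial>lborel) \<partial>lborel))"
  proof (intro sum.mono_neutral_left ballI)
    fix i assume "i \<in> {..<n} - P"
    then have "height i x = 0" using hx[of i] by (force simp: P_def)
    then show "ennreal (height i x) *
      (\<integral>\<^sup>+\<tau>\<in>{0..1}. (\<integral>\<^sup>+t\<in>{0..1}. ennreal \<tau> * f (x + of_real \<tau> * (edge i t - x)) \<partial>lborel) \<partial>lborel) = 0"
      by simp
  qed (auto simp: P_def)
  finally show ?thesis .
qed

text \<open>The region is convex and contains the vertices, which gives one inclusion. For the
  other, the edge minimising \<open>height j z / height j c\<close> yields a fan triangle with apex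
  \<open>c\<close> that contains \<open>z\<close>.\<close>

lemma region_eq_convex_hull:
  assumes c: "\<And>i. i < n \<Longrightarrow> 0 < height i c"
    and c_hull: "c \<in> convex hull (V ` {..<n})"
  shows "region = convex hull (V ` {..<n})"
proof
  have region: "region = (\<Inter>i<n. {z. - Im (cnj (V i) * V (Suc i)) \<le> Complex (Im (V i - V (Suc i))) (- Re (V i - V (Suc i))) \<bullet> z})"
    by (auto simp: region_def height_eq_inner algebra_simps)
  have "convex region"
    unfolding region by (intro convex_INT convex_halfspace_ge)
  moreover have "V ` {..<n} \<subseteq> region"
    by (auto simp: region_def height_vertex_nonneg)
  ultimately show "convex hull (V ` {..<n}) \<subseteq> region" by (rule hull_minimal[rotated])
  have VV: "V j \<in> convex hull (V ` {..<n})" for j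
    using hull_subset[of "V ` {..<n}"] vertex_mod[of j] three_le
    by (metis (no_types, lifting) imageI lessThan_iff mod_less_divisor order_less_le_trans subsetD zero_less_numeral)
  have creg: "c \<in> region" using c by (auto simp: region_def intro: less_imp_le)
  have tri: "\<exists>i<n. z \<in> convex hull {c, V i, V (Suc i)}" if z: "z \<in> region" for z
  proof -
    obtain i where i: "i < n" and min: "\<And>j. j < n \<Longrightarrow> height i z / height i c \<le> height j z / height j c"
      using ex_min_if_finite[of "(\<lambda>j. height j z / height j c) ` {..<n}"] three_le
      by (fastforce simp: not_less)
    define d where "d = height i c"
    have d: "0 < d" using c i by (simp add: d_def)
    \<comment> \<open>Cramer's rule for \<open>z - c\<close> in the basis \<open>V i - c\<close>,
      \<open>V (Suc i) - c\<close>.\<close>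
    define u v where "u = Im (cnj (z - c) * (V (Suc i) - c)) / d" and "v = Im (cnj (V i - c) * (z - c)) / d"
    have eq: "z = c + of_real u * (V i - c) + of_real v * (V (Suc i) - c)"
    proof -
      have cramer: "of_real (Im (cnj a * b)) * w = of_real (Im (cnj w * b)) * a + of_real (Im (cnj a * w)) * b" for a b w :: complex
        by (simp add: complex_eq_iff algebra_simps)
      have "of_real d * (z - c) = of_real (u * d) * (V i - c) + of_real (v * d) * (V (Suc i) - c)"
        using cramer[of "V i - c" "V (Suc i) - c" "z - c"] d unfolding u_def v_def
        by (simp add: d_def height_def)
      then have "of_real d * (z - c) = of_real d * (of_real u * (V i - c) + of_real v * (V (Suc i) - c))"
        by (simp add: algebra_simps)
      then show ?thesis using d by (simp add: add.assoc diff_eq_eq[symmetric] add.commute) (simp add: algebra_simps)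
    qed
    have "height i z * height j c \<le> height j z * height i c" if "j < n" for j
      using min[OF that] c[OF that] c[OF i] by (simp add: field_simps)
    then have "0 \<le> u \<and> 0 \<le> v \<and> u + v \<le> 1"
      using region_triangle_iff[OF i creg c[OF i] eq] z by blast
    moreover have "z = (1 - u - v) *\<^sub>R c + u *\<^sub>R V i + v *\<^sub>R V (Suc i)"
      unfolding eq by (simp add: scaleR_conv_of_real algebra_simps)
    ultimately have "z \<in> convex hull {c, V i, V (Suc i)}"
      unfolding convex_hull_3 mem_Collect_eq
      by (intro exI[of _ "1 - u - v"] exI[of _ u] exI[of _ v]) auto
    then show ?thesis using i by blast
  qed
  have "convex hull {c, V i, V (Suc i)} \<subseteq> convex hull (V ` {..<n})" for i
    using VV c_hull by (intro hull_minimal) auto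
  then show "region \<subseteq> convex hull (V ` {..<n})" using tri by blast
qed

end

section \<open>The mean distance as a sum over pairs of edges\<close>

lemma nn_integral_power_unit_interval:
  "(\<integral>\<^sup>+\<tau>\<in>{0..1}. ennreal (\<tau> ^ m) \<partial>lborel) = ennreal (1 / (real m + 1))"
proof -
  have "(\<integral>\<^sup>+\<tau>\<in>{0..1}. ennreal (\<tau> ^ m) \<partial>lborel)
    = ennreal (1 ^ Suc m / real (Suc m) - 0 ^ Suc m / real (Suc m))"
  proof (rule nn_integral_FTC_Icc)
    show "((\<lambda>x. x ^ Suc m / real (Suc m)) has_real_derivative x ^ m) (at x)" for x
      using DERIV_cdivide[OF DERIV_pow[of "Suc m" x], of "real (Suc m)"] by (simp del: of_nat_Suc)
  qed auto
  then show ?thesis by (simp add: add.commute)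
qed

context convex_polygon
begin

text \<open>Homogeneity contributes \<open>\<tau> ^ m\<close> besides the Jacobian
  \<open>\<tau>\<close>, so the radial integral separates from the integral along the edge.\<close>

lemma nn_integral_region_fan_homogeneous:
  assumes [measurable]: "g \<in> borel_measurable borel"
    and x: "x \<in> region"
    and not_vertex: "\<And>i j. \<lbrakk>i < n; j < n; height i x = 0; height j x = 0\<rbrakk> \<Longrightarrow> i = j"
    and hom: "\<And>\<tau> w. 0 \<le> \<tau> \<Longrightarrow> g (x + of_real \<tau> * (w - x)) = \<tau> ^ m * g w"
  shows "(\<integral>\<^sup>+z\<in>region. ennreal (g z) \<partial>lborel)
    = (\<Sum>i<n. ennreal (height i x) * (ennreal (1 / (real m + 2)) * (\<integral>\<^sup>+t\<in>{0..1}. ennreal (g (edge i t)) \<partial>lborel)))"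
proof -
  have "(\<integral>\<^sup>+\<tau>\<in>{0..1}. (\<integral>\<^sup>+t\<in>{0..1}. ennreal \<tau> * ennreal (g (x + of_real \<tau> * (edge i t - x))) \<partial>lborel) \<partial>lborel)
    = ennreal (1 / (real m + 2)) * (\<integral>\<^sup>+t\<in>{0..1}. ennreal (g (edge i t)) \<partial>lborel)" for i
  proof -
    have "(\<integral>\<^sup>+\<tau>\<in>{0..1}. (\<integral>\<^sup>+t\<in>{0..1}. ennreal \<tau> * ennreal (g (x + of_real \<tau> * (edge i t - x))) \<partial>lborel) \<partial>lborel)
      = (\<integral>\<^sup>+\<tau>. ennreal (\<tau> ^ Suc m) * indicator {0..1} \<tau> * (\<integral>\<^sup>+t\<in>{0..1}. ennreal (g (edge i t)) \<partial>lborel) \<partial>lborel)"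
    proof (rule nn_integral_cong)
      fix \<tau> :: real
      show "(\<integral>\<^sup>+t\<in>{0..1}. ennreal \<tau> * ennreal (g (x + of_real \<tau> * (edge i t - x))) \<partial>lborel) * indicator {0..1} \<tau>
        = ennreal (\<tau> ^ Suc m) * indicator {0..1} \<tau> * (\<integral>\<^sup>+t\<in>{0..1}. ennreal (g (edge i t)) \<partial>lborel)"
      proof (cases "\<tau> \<in> {0..1}")
        case True
        then have "ennreal \<tau> * ennreal (g (x + of_real \<tau> * (edge i t - x))) * indicator {0..1} t
            = ennreal (\<tau> ^ Suc m) * (ennreal (g (edge i t)) * indicator {0..1} t)" for t
          by (simp add: hom ennreal_mult' mult.assoc)
        then show ?thesis using True by (simp add: nn_integral_cmult)
      qed simp
    qed
    also have "\<dots> = ennreal (1 / (real (Suc m) + 1)) * (\<integral>\<^sup>+t\<in>{0..1}. ennreal (g (edge i t)) \<partial>lborel)"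
      by (subst nn_integral_multc) (simp_all only: nn_integral_power_unit_interval, measurable)
    finally show ?thesis by (simp add: add.commute)
  qed
  then show ?thesis
    by (subst nn_integral_region_fan[OF _ x not_vertex]) simp_all
qed

lemma height_edge: "height i (edge j t) = (1 - t) * height i (V j) + t * height i (V (Suc j))"
  using height_affine[of i 0 "1 - t" "V j" t "V (Suc j)"] by (simp add: edge_def)

lemma edge_in_region: "t \<in> {0..1} \<Longrightarrow> edge j t \<in> region"
  by (simp add: region_def height_edge height_vertex_nonneg)

text \<open>At least one endpoint of edge \<open>j\<close> is off the line of edge \<open>i\<close>,
  and at an interior point it enters with positive weight.\<close>

lemma height_edge_pos:
  assumes "i < n" "j < n" "i \<noteq> j" "0 < t" "t < 1"
  shows "0 < height i (edge j t)"
proof -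
  have "0 < height i (V j) \<or> 0 < height i (V (Suc j))"
  proof (cases "j mod n = Suc i mod n")
    case False
    then show ?thesis using height_vertex_pos[of j i] assms by simp
  next
    case True
    then have "Suc j mod n = Suc (Suc i) mod n" by (metis mod_Suc_eq)
    then show ?thesis using vertex_cong height_vertex_next[of i] by metis
  qed
  then show ?thesis using assms height_vertex_nonneg[of i]
    by (auto simp: height_edge intro: add_pos_nonneg add_nonneg_pos)
qed

text \<open>The two heights come from different fans: \<open>height j\<close> is the determinant of
  the triangle over edge \<open>j\<close> seen from \<open>x\<close>, and \<open>height i\<close>
  that of the triangle over edge \<open>i\<close> seen from the point
  \<open>edge j t\<close>.\<close>

lemma nn_integral_dist_region:
  "(\<integral>\<^sup>+x\<in>region. (\<integral>\<^sup>+y\<in>region. ennreal (dist x y) \<partial>lborel) \<partial>lborel)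
    = ennreal (1 / 12) * (\<Sum>j<n. \<Sum>i<n. \<integral>\<^sup>+t\<in>{0..1}. (\<integral>\<^sup>+s\<in>{0..1}.
        ennreal (height i (edge j t) * height j (edge i s) * dist (edge j t) (edge i s)) \<partial>lborel) \<partial>lborel)"
proof -
  have dist_hom: "dist x (x + of_real \<tau> * (w - x)) = \<tau> ^ 1 * dist x w" if "0 \<le> \<tau>" for x w :: complex and \<tau> :: real
    using that by (simp add: dist_norm norm_mult norm_minus_commute)
  have outer: "(\<integral>\<^sup>+y\<in>region. ennreal (dist x y) \<partial>lborel)
    = (\<Sum>j<n. ennreal (height j x) * (ennreal (1 / 3) * (\<integral>\<^sup>+t\<in>{0..1}. ennreal (dist x (edge j t)) \<partial>lborel)))"
    if "x \<in> region" "\<forall>i<n. height i x \<noteq> 0" for x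
    using nn_integral_region_fan_homogeneous[of "dist x" x 1] that dist_hom by simp
  have inner: "(\<integral>\<^sup>+x\<in>region. ennreal (height j x * dist x (edge j t)) \<partial>lborel)
    = ennreal (1 / 4) * (\<Sum>i<n. (\<integral>\<^sup>+s\<in>{0..1}. ennreal (height i (edge j t) * height j (edge i s) * dist (edge j t) (edge i s)) \<partial>lborel))"
    if t: "0 < t" "t < 1" and j: "j < n" for t j
  proof -
    let ?g = "\<lambda>x. height j x * dist (edge j t) x"
    \<comment> \<open>Being affine and zero at the apex, \<open>height j\<close> scales with
      \<open>\<tau>\<close>; together with the distance this makes degree 2.\<close>
    have "height j (edge j t) = 0" by (simp add: height_edge)
    then have hom: "?g (edge j t + of_real \<tau> * (w - edge j t)) = \<tau> ^ 2 * ?g w" if "0 \<le> \<tau>" for \<tau> w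
      using height_affine[of j "edge j t" \<tau> w 0 0] dist_hom[OF that, of "edge j t" w]
      by (simp add: power2_eq_square)
    have nv: "i = k" if "i < n" "k < n" "height i (edge j t) = 0" "height k (edge j t) = 0" for i k
      using height_edge_pos[OF that(1) j _ t] height_edge_pos[OF that(2) j _ t] that by force
    have reg: "edge j t \<in> region" using t by (intro edge_in_region) simp
    have "(\<integral>\<^sup>+x\<in>region. ennreal (height j x * dist x (edge j t)) \<partial>lborel)
      = (\<integral>\<^sup>+x\<in>region. ennreal (?g x) \<partial>lborel)" by (simp add: dist_commute)
    also have "\<dots> = (\<Sum>i<n. ennreal (height i (edge j t)) * (ennreal (1 / (real 2 + 2)) * (\<integral>\<^sup>+s\<in>{0..1}. ennreal (?g (edge i s)) \<partial>lborel)))"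
      by (rule nn_integral_region_fan_homogeneous[OF _ reg nv hom]) measurable
    also have "\<dots> = (\<Sum>i<n. ennreal (1 / 4) * (\<integral>\<^sup>+s\<in>{0..1}. ennreal (height i (edge j t) * height j (edge i s) * dist (edge j t) (edge i s)) \<partial>lborel))"
    proof (intro sum.cong refl)
      fix i
      have "(\<integral>\<^sup>+s\<in>{0..1}. ennreal (height i (edge j t) * height j (edge i s) * dist (edge j t) (edge i s)) \<partial>lborel)
        = ennreal (height i (edge j t)) * (\<integral>\<^sup>+s\<in>{0..1}. ennreal (?g (edge i s)) \<partial>lborel)"
        by (subst nn_integral_cmult[symmetric])
          (simp_all add: ennreal_mult'[OF height_nonneg[OF reg]] mult.assoc)
      then show "ennreal (height i (edge j t)) * (ennreal (1 / (real 2 + 2)) * (\<integral>\<^sup>+s\<in>{0..1}. ennreal (?g (edge i s)) \<partial>lborel))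
        = ennreal (1 / 4) * (\<integral>\<^sup>+s\<in>{0..1}. ennreal (height i (edge j t) * height j (edge i s) * dist (edge j t) (edge i s)) \<partial>lborel)"
        by (simp add: mult.left_commute)
    qed
    finally show ?thesis by (simp add: sum_distrib_left)
  qed
  have twelve: "ennreal (1 / 3) * (ennreal (1 / 4) * X) = ennreal (1 / 12) * X" for X
    unfolding mult.assoc[symmetric] by (subst ennreal_mult[symmetric]) simp_all
  have "AE x in lborel. \<forall>i<n. height i x \<noteq> 0"
  proof -
    have "{x. height i x = 0} \<in> null_sets lborel" for i
      by (rule null_set_affine_complex[OF height_eq_inner, of _ "V (Suc (Suc i))"]) (use height_vertex_next[of i] in auto)
    from AE_not_in[OF this] have "AE x in lborel. \<forall>i\<in>{..<n}. height i x \<noteq> 0"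
      by (intro AE_finite_allI) auto
    then show ?thesis by eventually_elim auto
  qed
  then have "(\<integral>\<^sup>+x\<in>region. (\<integral>\<^sup>+y\<in>region. ennreal (dist x y) \<partial>lborel) \<partial>lborel)
    = (\<integral>\<^sup>+x. (\<Sum>j<n. ennreal (1 / 3) * (\<integral>\<^sup>+t. ennreal (height j x * dist x (edge j t)) * indicator {0..1} t * indicator region x \<partial>lborel)) \<partial>lborel)"
  proof (intro nn_integral_cong_AE, eventually_elim)
    case (elim x)
    show ?case
    proof (cases "x \<in> region")
      case True
      have "(\<integral>\<^sup>+t. ennreal (height j x * dist x (edge j t)) * indicator {0..1} t * indicator region x \<partial>lborel)
        = ennreal (height j x) * (\<integral>\<^sup>+t\<in>{0..1}. ennreal (dist x (edge j t)) \<partial>lborel)" for j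
        using True by (subst nn_integral_cmult[symmetric])
          (simp_all add: ennreal_mult'[OF height_nonneg[OF True]] mult.assoc)
      then show ?thesis using True by (simp add: outer[OF True elim(2)] mult.left_commute)
    qed simp
  qed
  also have "\<dots> = (\<Sum>j<n. ennreal (1 / 3) * (\<integral>\<^sup>+x. \<integral>\<^sup>+t. ennreal (height j x * dist x (edge j t)) * indicator {0..1} t * indicator region x \<partial>lborel \<partial>lborel))"
    by (subst nn_integral_sum) (simp_all add: nn_integral_cmult)
  \<comment> \<open>After the exchange the point \<open>edge j t\<close> is fixed and can serve as
    apex for the integral over \<open>x\<close>.\<close>
  also have "\<dots> = (\<Sum>j<n. ennreal (1 / 3) * (\<integral>\<^sup>+t. \<integral>\<^sup>+x. ennreal (height j x * dist x (edge j t)) * indicator {0..1} t * indicator region x \<partial>lborel \<partial>lborel))"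
    by (intro sum.cong refl arg_cong[where f = "\<lambda>u. _ * u"] nn_integral_lborel_swap)
      (simp add: borel_prod[symmetric] case_prod_unfold)
  also have "\<dots> = (\<Sum>j<n. ennreal (1 / 3) * (\<integral>\<^sup>+t. ennreal (1 / 4) * (\<Sum>i<n. (\<integral>\<^sup>+s\<in>{0..1}.
        ennreal (height i (edge j t) * height j (edge i s) * dist (edge j t) (edge i s)) \<partial>lborel) * indicator {0..1} t) \<partial>lborel))"
  proof (intro sum.cong refl arg_cong[where f = "\<lambda>u. _ * u"] nn_integral_cong_AE)
    fix j assume j: "j \<in> {..<n}"
    \<comment> \<open>At these two values the apex would be a vertex and lie on two edge
      lines.\<close>
    have "AE t in lborel. t \<noteq> (0::real)" "AE t in lborel. t \<noteq> (1::real)" by (rule AE_lborel_singleton)+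
    then show "AE t in lborel. (\<integral>\<^sup>+x. ennreal (height j x * dist x (edge j t)) * indicator {0..1} t * indicator region x \<partial>lborel)
      = ennreal (1 / 4) * (\<Sum>i<n. (\<integral>\<^sup>+s\<in>{0..1}.
        ennreal (height i (edge j t) * height j (edge i s) * dist (edge j t) (edge i s)) \<partial>lborel) * indicator {0..1} t)"
    proof eventually_elim
      case (elim t)
      show ?case
      proof (cases "t \<in> {0..1}")
        case True
        then show ?thesis using elim j inner[of t j] by simp
      qed simp
    qed
  qed
  also have "\<dots> = (\<Sum>j<n. ennreal (1 / 3) * (ennreal (1 / 4) * (\<Sum>i<n. \<integral>\<^sup>+t\<in>{0..1}. (\<integral>\<^sup>+s\<in>{0..1}.
        ennreal (height i (edge j t) * height j (edge i s) * dist (edge j t) (edge i s)) \<partial>lborel) \<partial>lborel)))"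
    by (intro sum.cong refl arg_cong[where f = "\<lambda>u. _ * u"], subst nn_integral_cmult, measurable)
      (subst nn_integral_sum, measurable)
  finally show ?thesis by (simp only: twelve sum_distrib_left)
qed

text \<open>The fan about \<open>c\<close> for the constant function 1, which has degree 0.\<close>

lemma emeasure_region:
  assumes c: "\<And>i. i < n \<Longrightarrow> 0 < height i c"
  shows "emeasure lborel region = ennreal ((\<Sum>i<n. height i c) / 2)"
proof -
  have creg: "c \<in> region" using c by (auto simp: region_def intro: less_imp_le)
  have "emeasure lborel region = (\<integral>\<^sup>+z\<in>region. ennreal 1 \<partial>lborel)" by simp
  also have "\<dots> = (\<Sum>i<n. ennreal (height i c) * (ennreal (1 / (real 0 + 2)) * (\<integral>\<^sup>+t\<in>{0..1::real}. ennreal 1 \<partial>lborel)))"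
  proof (rule nn_integral_region_fan_homogeneous[of "\<lambda>_. 1" c 0])
    show "i = j" if "i < n" "j < n" "height i c = 0" "height j c = 0" for i j
      using c[OF that(1)] that by simp
  qed (use creg in simp_all)
  also have "\<dots> = (\<Sum>i<n. ennreal (height i c / 2))"
  proof (intro sum.cong refl)
    fix i assume "i \<in> {..<n}"
    then have "ennreal (height i c / 2) = ennreal (height i c) * ennreal (1 / (real 0 + 2))"
      using c[of i] by (subst ennreal_mult'[symmetric]) auto
    then show "ennreal (height i c) * (ennreal (1 / (real 0 + 2)) * (\<integral>\<^sup>+t\<in>{0..1::real}. ennreal 1 \<partial>lborel)) = ennreal (height i c / 2)"
      by simp
  qed
  also have "\<dots> = ennreal ((\<Sum>i<n. height i c) / 2)"
    by (subst sum_ennreal) (auto simp: sum_divide_distrib c less_imp_le)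
  finally show ?thesis .
qed

text \<open>The area is half of the sum of the heights, so dividing 1/12 by its square leaves the
  factor 1/3. \<open>J\<close> is a placeholder for closed forms; its nonnegativity allows the sums
  to be moved inside \<open>ennreal\<close>.\<close>

lemma mean_distance_region:
  assumes c: "\<And>i. i < n \<Longrightarrow> 0 < height i c"
    and J: "\<And>i j. \<lbrakk>i < n; j < n\<rbrakk> \<Longrightarrow> (\<integral>\<^sup>+t\<in>{0..1}. (\<integral>\<^sup>+s\<in>{0..1}.
        ennreal (height i (edge j t) * height j (edge i s) * dist (edge j t) (edge i s)) \<partial>lborel) \<partial>lborel) = ennreal (J i j)"
    and J_nonneg: "\<And>i j. \<lbrakk>i < n; j < n\<rbrakk> \<Longrightarrow> 0 \<le> J i j"
  shows "mean_distance region = (\<Sum>j<n. \<Sum>i<n. J i j) / (3 * (\<Sum>i<n. height i c)\<^sup>2)"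
proof -
  define A where "A = (\<Sum>i<n. height i c) / 2"
  have A: "emeasure lborel region = ennreal A" unfolding A_def by (rule emeasure_region[OF c])
  have "0 < (\<Sum>i<n. height i c)" using c three_le by (intro sum_pos) (auto simp: lessThan_empty_iff)
  then have Apos: "0 < A" by (simp add: A_def)
  let ?U = "uniform_measure lborel region"
  interpret U: prob_space ?U
    by (rule prob_space_uniform_measure) (use A Apos in auto)
  have [measurable_cong]: "sets ?U = sets borel" by simp
  have dist_meas: "(\<lambda>z. dist (fst z) (snd z)) \<in> borel_measurable (?U \<Otimes>\<^sub>M ?U)" by measurable
  have S_nonneg: "0 \<le> (\<Sum>j<n. \<Sum>i<n. J i j)" using J_nonneg by (intro sum_nonneg) auto
  have "(\<integral>\<^sup>+z. ennreal (dist (fst z) (snd z)) \<partial>(?U \<Otimes>\<^sub>M ?U))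
    = (\<integral>\<^sup>+x. \<integral>\<^sup>+y. ennreal (dist x y) \<partial>?U \<partial>?U)"
    by (subst U.nn_integral_fst[symmetric]) (use dist_meas in simp_all)
  also have "\<dots> = (\<integral>\<^sup>+x\<in>region. ((\<integral>\<^sup>+y\<in>region. ennreal (dist x y) \<partial>lborel) / ennreal A) \<partial>lborel) / ennreal A"
    by (simp add: nn_integral_uniform_measure A)
  also have "\<dots> = (\<integral>\<^sup>+x\<in>region. (\<integral>\<^sup>+y\<in>region. ennreal (dist x y) \<partial>lborel) \<partial>lborel) / ennreal A / ennreal A"
  proof -
    have "(\<integral>\<^sup>+x\<in>region. ((\<integral>\<^sup>+y\<in>region. ennreal (dist x y) \<partial>lborel) / ennreal A) \<partial>lborel)
      = (\<integral>\<^sup>+x. (\<integral>\<^sup>+y\<in>region. ennreal (dist x y) \<partial>lborel) * indicator region x * inverse (ennreal A) \<partial>lborel)"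
      by (intro nn_integral_cong) (simp add: divide_ennreal_def mult_ac)
    also have "\<dots> = (\<integral>\<^sup>+x\<in>region. (\<integral>\<^sup>+y\<in>region. ennreal (dist x y) \<partial>lborel) \<partial>lborel) * inverse (ennreal A)"
      by (rule nn_integral_multc) measurable
    finally show ?thesis by (simp only: divide_ennreal_def)
  qed
  also have "\<dots> = ennreal (1 / 12 * (\<Sum>j<n. \<Sum>i<n. J i j) / A / A)"
    using S_nonneg Apos
  proof -
    have "(\<Sum>j<n. \<Sum>i<n. ennreal (J i j)) = ennreal (\<Sum>j<n. \<Sum>i<n. J i j)"
    proof -
      have "(\<Sum>j<n. \<Sum>i<n. ennreal (J i j)) = (\<Sum>j<n. ennreal (\<Sum>i<n. J i j))"
        by (intro sum.cong refl sum_ennreal) (auto intro: J_nonneg)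
      also have "\<dots> = ennreal (\<Sum>j<n. \<Sum>i<n. J i j)"
        by (intro sum_ennreal sum_nonneg) (auto intro: J_nonneg)
      finally show ?thesis .
    qed
    then show ?thesis using S_nonneg Apos
      by (simp add: nn_integral_dist_region J ennreal_mult'[symmetric] divide_ennreal)
  qed
  finally have nn: "(\<integral>\<^sup>+z. ennreal (dist (fst z) (snd z)) \<partial>(?U \<Otimes>\<^sub>M ?U)) = ennreal (1 / 12 * (\<Sum>j<n. \<Sum>i<n. J i j) / A / A)" .
  have "mean_distance region = enn2real (\<integral>\<^sup>+z. ennreal (dist (fst z) (snd z)) \<partial>(?U \<Otimes>\<^sub>M ?U))"
    unfolding mean_distance_def by (rule integral_eq_nn_integral) (use dist_meas in auto)
  also have "\<dots> = 1 / 12 * (\<Sum>j<n. \<Sum>i<n. J i j) / A / A"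
    unfolding nn using S_nonneg Apos by simp
  finally show ?thesis by (simp add: A_def power2_eq_square)
qed

end

section \<open>Integrals over pairs of line segments\<close>

text \<open>The square is cut along the diagonal, and reflection maps the upper part to the lower
  one up to the diagonal, which meets each line of integration in one point.\<close>

lemma nn_integral_square_symmetric:
  fixes h :: "real \<Rightarrow> real \<Rightarrow> ennreal"
  assumes h: "(\<lambda>(p, q). h p q) \<in> borel_measurable borel"
    and sym: "\<And>p q. h p q = h q p"
  shows "(\<integral>\<^sup>+p\<in>{a..b}. (\<integral>\<^sup>+q\<in>{a..b}. h p q \<partial>lborel) \<partial>lborel)
    = 2 * (\<integral>\<^sup>+p\<in>{a..b}. (\<integral>\<^sup>+q\<in>{a..p}. h p q \<partial>lborel) \<partial>lborel)"
proof -
  have [measurable]: "(\<lambda>z. h (f z) (g z)) \<in> borel_measurable M"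
    if [measurable]: "f \<in> borel_measurable M" "g \<in> borel_measurable M" for f g and M :: "'z measure"
    using measurable_compose[OF _ h, of "\<lambda>z. (f z, g z)" M] by simp
  define lower where "lower p q = h p q * indicator {a..p} q * indicator {a..b} p" for p q
  define upper where "upper p q = h p q * (indicator {p<..b} q * indicator {a..b} p)" for p q
  have [measurable]: "(\<lambda>z. lower (fst z) (snd z)) \<in> borel_measurable (borel \<Otimes>\<^sub>M borel)"
    unfolding lower_def by (simp add: indicator_def)
  have [measurable]: "lower p \<in> borel_measurable borel" "upper p \<in> borel_measurable borel" for p
    unfolding lower_def upper_def by measurable
  have [measurable]: "(\<lambda>z. upper (fst z) (snd z)) \<in> borel_measurable (borel \<Otimes>\<^sub>M borel)"
    unfolding upper_def by (simp add: indicator_def)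
  have [measurable]: "(\<lambda>p. \<integral>\<^sup>+q. lower p q \<partial>lborel) \<in> borel_measurable borel" "(\<lambda>p. \<integral>\<^sup>+q. upper p q \<partial>lborel) \<in> borel_measurable borel"
    by (simp_all add: lborel.borel_measurable_nn_integral case_prod_unfold)
  have "(\<integral>\<^sup>+p\<in>{a..b}. (\<integral>\<^sup>+q\<in>{a..b}. h p q \<partial>lborel) \<partial>lborel) = (\<integral>\<^sup>+p. (\<integral>\<^sup>+q. lower p q + upper p q \<partial>lborel) \<partial>lborel)"
    by (subst nn_integral_multc[symmetric], simp, intro nn_integral_cong)
      (auto simp: lower_def upper_def indicator_def)
  also have "\<dots> = (\<integral>\<^sup>+p. \<integral>\<^sup>+q. lower p q \<partial>lborel \<partial>lborel) + (\<integral>\<^sup>+p. \<integral>\<^sup>+q. upper p q \<partial>lborel \<partial>lborel)"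
    by (simp add: nn_integral_add)
  also have "(\<integral>\<^sup>+p. \<integral>\<^sup>+q. upper p q \<partial>lborel \<partial>lborel) = (\<integral>\<^sup>+q. \<integral>\<^sup>+p. upper p q \<partial>lborel \<partial>lborel)"
    by (rule nn_integral_lborel_swap) (simp add: borel_prod[symmetric] case_prod_unfold)
  also have "\<dots> = (\<integral>\<^sup>+p. \<integral>\<^sup>+q. lower p q \<partial>lborel \<partial>lborel)"
  proof (rule nn_integral_cong, rule nn_integral_cong_AE)
    fix p :: real
    have "AE q in lborel. q \<noteq> p" by (rule AE_lborel_singleton)
    then show "AE q in lborel. upper q p = lower p q"
      by eventually_elim (auto simp: lower_def upper_def sym[of p] indicator_def)
  qed
  also have "(\<integral>\<^sup>+p. \<integral>\<^sup>+q. lower p q \<partial>lborel \<partial>lborel) = (\<integral>\<^sup>+p\<in>{a..b}. (\<integral>\<^sup>+q\<in>{a..p}. h p q \<partial>lborel) \<partial>lborel)"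
    unfolding lower_def by (intro nn_integral_cong nn_integral_multc) measurable
  finally show ?thesis by (simp add: mult_2)
qed

text \<open>\<^term>\<open>leg_dist \<kappa> w\<close> is the distance between the points at distances \<open>1\<close> and \<open>w\<close> from the vertex
  on the two legs of an angle with cosine \<open>- \<kappa>\<close>.\<close>

definition leg_dist :: "real \<Rightarrow> real \<Rightarrow> real" where
  "leg_dist \<kappa> w = sqrt (w\<^sup>2 + 2 * \<kappa> * w + 1)"

text \<open>A primitive of \<open>w * D\<close> for \<open>D = leg_dist \<kappa> w\<close>, found
  from \<open>w * D = (w + \<kappa>) * D - \<kappa> * D\<close>: the first part integrates to
  \<open>D ^ 3 / 3\<close>, the second is the standard integral of the root of a quadratic.\<close>

definition leg_primitive :: "real \<Rightarrow> real \<Rightarrow> real" where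
  "leg_primitive \<kappa> w = leg_dist \<kappa> w ^ 3 / 3
    - \<kappa> * ((w + \<kappa>) * leg_dist \<kappa> w / 2 + (1 - \<kappa>\<^sup>2) / 2 * ln (w + \<kappa> + leg_dist \<kappa> w))"

text \<open>The radicand is \<open>(w + \<kappa>)\<^sup>2 + (1 - \<kappa>\<^sup>2)\<close>, so its
  root exceeds \<open>\<bar>w + \<kappa>\<bar>\<close>. This makes the argument of the logarithm in
  the primitive positive.\<close>

lemma leg_dist_pos:
  assumes "\<bar>\<kappa>\<bar> < 1"
  shows "0 < leg_dist \<kappa> w" "0 < w + \<kappa> + leg_dist \<kappa> w" "(leg_dist \<kappa> w)\<^sup>2 = w\<^sup>2 + 2 * \<kappa> * w + 1"
proof -
  have k: "\<kappa>\<^sup>2 < 1" using assms by (simp add: abs_square_less_1)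
  have eq: "w\<^sup>2 + 2 * \<kappa> * w + 1 = (w + \<kappa>)\<^sup>2 + (1 - \<kappa>\<^sup>2)" by (simp add: power2_eq_square algebra_simps)
  have gt: "(w + \<kappa>)\<^sup>2 < w\<^sup>2 + 2 * \<kappa> * w + 1" unfolding eq using k by simp
  then have pos: "0 < w\<^sup>2 + 2 * \<kappa> * w + 1" using zero_le_power2[of "w + \<kappa>"] by linarith
  then show "0 < leg_dist \<kappa> w" "(leg_dist \<kappa> w)\<^sup>2 = w\<^sup>2 + 2 * \<kappa> * w + 1" by (simp_all add: leg_dist_def)
  have "\<bar>w + \<kappa>\<bar> < leg_dist \<kappa> w"
    unfolding leg_dist_def by (rule real_less_rsqrt) (use gt in simp)
  then show "0 < w + \<kappa> + leg_dist \<kappa> w" by linarith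
qed

lemma DERIV_leg_primitive:
  assumes "\<bar>\<kappa>\<bar> < 1"
  shows "(leg_primitive \<kappa> has_real_derivative w * leg_dist \<kappa> w) (at w)"
proof -
  note pos = leg_dist_pos[OF assms, of w]
  define D where "D = leg_dist \<kappa> w"
  have D: "0 < D" "0 < w + \<kappa> + D" "D\<^sup>2 = w\<^sup>2 + 2 * \<kappa> * w + 1" using pos by (simp_all add: D_def)
  have "0 < w\<^sup>2 + 2 * \<kappa> * w + 1" using D by (metis zero_less_power)
  then have D': "(leg_dist \<kappa> has_real_derivative (w + \<kappa>) / D) (at w)"
    unfolding leg_dist_def[abs_def] D_def
    by (auto intro!: derivative_eq_intros simp: field_simps)
  have lin: "((\<lambda>w. w + \<kappa>) has_real_derivative 1) (at w)" by (auto intro!: derivative_eq_intros)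
  have ln': "((\<lambda>w. ln (w + \<kappa> + leg_dist \<kappa> w)) has_real_derivative 1 / (w + \<kappa> + leg_dist \<kappa> w) * (1 + (w + \<kappa>) / D)) (at w)"
    by (rule DERIV_chain2[OF DERIV_ln_divide[OF pos(2)] DERIV_add[OF lin D']])
  have half: "(1 * D + x) / 2 + z = D" if "x + y = D" "z = y / 2" for x y z :: real
    using that by (simp add: field_simps)
  have log: "1 / (w + \<kappa> + D) * (1 + (w + \<kappa>) / D) = 1 / D" using D by (simp add: field_simps)
  \<comment> \<open>By this identity the derivatives of the product term and of the logarithmic term
    combine to \<open>D\<close>.\<close>
  have "(w + \<kappa>)\<^sup>2 + (1 - \<kappa>\<^sup>2) = D\<^sup>2" unfolding D(3) by (simp add: power2_eq_square algebra_simps)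
  then have "((w + \<kappa>)\<^sup>2 + (1 - \<kappa>\<^sup>2)) / D = D"
    using D(1) by (simp add: power2_eq_square)
  then have "(w + \<kappa>) / D * (w + \<kappa>) + (1 - \<kappa>\<^sup>2) * (1 / D) = D"
    by (simp add: add_divide_distrib[symmetric] power2_eq_square)
  moreover have "(1 - \<kappa>\<^sup>2) / 2 * (1 / D) = ((1 - \<kappa>\<^sup>2) * (1 / D)) / 2" by simp
  ultimately have e1: "(1 * D + (w + \<kappa>) / D * (w + \<kappa>)) / 2 + (1 - \<kappa>\<^sup>2) / 2 * (1 / D) = D"
    by (rule half)
  have e2: "of_nat 3 * ((w + \<kappa>) / D * D ^ (3 - Suc 0)) / 3 = D * (w + \<kappa>)"
    using D(1) by (simp add: power2_eq_square)
  have "((\<lambda>w. leg_primitive \<kappa> w) has_real_derivative w * D) (at w)"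
    unfolding leg_primitive_def
  proof (rule DERIV_cong[OF DERIV_diff[OF DERIV_cdivide[OF DERIV_power[OF D', of 3], of 3]
      DERIV_cmult[OF DERIV_add[OF DERIV_cdivide[OF DERIV_mult[OF lin D'], of 2]
        DERIV_cmult[OF ln', of "(1 - \<kappa>\<^sup>2) / 2"]], of \<kappa>]]])
    show "of_nat 3 * ((w + \<kappa>) / D * leg_dist \<kappa> w ^ (3 - Suc 0)) / 3 -
      \<kappa> * ((1 * leg_dist \<kappa> w + (w + \<kappa>) / D * (w + \<kappa>)) / 2
        + (1 - \<kappa>\<^sup>2) / 2 * (1 / (w + \<kappa> + leg_dist \<kappa> w) * (1 + (w + \<kappa>) / D))) = w * D"
      unfolding D_def[symmetric] log e1 e2 by (simp add: algebra_simps)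
  qed
  then show ?thesis by (simp add: D_def)
qed

lemma leg_dist_measurable [measurable]: "leg_dist \<kappa> \<in> borel_measurable borel"
  unfolding leg_dist_def[abs_def] by measurable

lemma nn_integral_power4_Icc:
  assumes "0 \<le> a" "a \<le> b"
  shows "(\<integral>\<^sup>+p\<in>{a..b}. ennreal (p ^ 4) \<partial>lborel) = ennreal ((b ^ 5 - a ^ 5) / 5)"
proof -
  have "(\<integral>\<^sup>+p\<in>{a..b}. ennreal (p ^ 4) \<partial>lborel) = ennreal (b ^ 5 / 5 - a ^ 5 / 5)"
    by (rule nn_integral_FTC_Icc) (use assms in \<open>auto intro!: derivative_eq_intros\<close>)
  then show ?thesis by (simp add: diff_divide_distrib)
qed

lemma leg_dist_scale:
  assumes "0 < p"
  shows "sqrt (p\<^sup>2 + (p * w)\<^sup>2 + 2 * \<kappa> * p * (p * w)) = p * leg_dist \<kappa> w"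
proof -
  have "p\<^sup>2 + (p * w)\<^sup>2 + 2 * \<kappa> * p * (p * w) = p\<^sup>2 * (w\<^sup>2 + 2 * \<kappa> * w + 1)"
    by (simp add: power2_eq_square algebra_simps)
  then show ?thesis using assms by (simp add: leg_dist_def real_sqrt_mult)
qed

text \<open>Homogeneity reduces the double integral over a square to a single one: below the diagonal
  substitute \<open>q = p * w\<close> and integrate over \<open>p\<close> first.\<close>

lemma nn_integral_leg_square:
  fixes a b \<kappa> :: real
  assumes k: "\<bar>\<kappa>\<bar> < 1" and a: "0 \<le> a" and ab: "a < b"
  shows "(\<integral>\<^sup>+p\<in>{a..b}. (\<integral>\<^sup>+q\<in>{a..b}. ennreal (p * q * sqrt (p\<^sup>2 + q\<^sup>2 + 2 * \<kappa> * p * q)) \<partial>lborel) \<partial>lborel)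
    = ennreal (2 / 5 * (b ^ 5 * (leg_primitive \<kappa> 1 - leg_primitive \<kappa> (a / b))
        - a ^ 5 * (leg_primitive \<kappa> (b / a) - leg_primitive \<kappa> 1)))"
    and "0 \<le> 2 / 5 * (b ^ 5 * (leg_primitive \<kappa> 1 - leg_primitive \<kappa> (a / b))
        - a ^ 5 * (leg_primitive \<kappa> (b / a) - leg_primitive \<kappa> 1))"
proof -
  let ?D = "leg_dist \<kappa>" and ?A = "leg_primitive \<kappa>"
  have b: "0 < b" using a ab by simp
  \<comment> \<open>A primitive of \<open>(b ^ 5 - (a / w) ^ 5) / 5 * (w * ?D w)\<close>. The part
    with \<open>a ^ 5\<close> has integrand \<open>?D w / w ^ 4\<close>, which passing to
    \<open>1 / w\<close> turns back into the first kind, because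
    \<open>?D (1 / w) = ?D w / w\<close>.\<close>
  define F where "F w = (b ^ 5 * ?A w + a ^ 5 * ?A (1 / w)) / 5" for w
  \<comment> \<open>The half of the square below the diagonal in the coordinates \<open>p\<close>
    and \<open>w = q / p\<close>.\<close>
  define S where "S = {(p, w). p \<in> {a..b} \<and> w \<in> {0..1} \<and> a \<le> p * w}"
  have "S = {z \<in> space (borel \<Otimes>\<^sub>M borel). fst z \<in> {a..b} \<and> snd z \<in> {0..1} \<and> a \<le> fst z * snd z}"
    by (auto simp: S_def space_pair_measure)
  then have [measurable]: "S \<in> sets (borel \<Otimes>\<^sub>M borel)" by simp
  have lower: "(\<integral>\<^sup>+q\<in>{a..p}. ennreal (p * q * sqrt (p\<^sup>2 + q\<^sup>2 + 2 * \<kappa> * p * q)) \<partial>lborel) * indicator {a..b} p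
    = (\<integral>\<^sup>+w. ennreal (p ^ 4 * (w * ?D w)) * indicator S (p, w) \<partial>lborel)" if "p \<noteq> 0" for p
  proof (cases "p \<in> {a..b}")
    case True
    then have p: "0 < p" using that a by simp
    have "(\<integral>\<^sup>+q\<in>{a..p}. ennreal (p * q * sqrt (p\<^sup>2 + q\<^sup>2 + 2 * \<kappa> * p * q)) \<partial>lborel)
      = ennreal \<bar>p\<bar> * (\<integral>\<^sup>+w. ennreal (p * (0 + p * w) * sqrt (p\<^sup>2 + (0 + p * w)\<^sup>2 + 2 * \<kappa> * p * (0 + p * w))) * indicator {a..p} (0 + p * w) \<partial>lborel)"
      by (rule nn_integral_real_affine) (use that in auto)
    also have "\<dots> = (\<integral>\<^sup>+w. ennreal \<bar>p\<bar> * (ennreal (p * (p * w) * sqrt (p\<^sup>2 + (p * w)\<^sup>2 + 2 * \<kappa> * p * (p * w))) * indicator {a..p} (p * w)) \<partial>lborel)"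
      by (subst nn_integral_cmult) simp_all
    also have "\<dots> = (\<integral>\<^sup>+w. ennreal (p ^ 4 * (w * ?D w)) * indicator S (p, w) \<partial>lborel)"
    proof (rule nn_integral_cong)
      fix w :: real
      have "a \<le> p * w \<and> p * w \<le> p \<longleftrightarrow> w \<in> {0..1} \<and> a \<le> p * w"
        using p a mult_less_0_iff[of p w] by (auto simp: not_le[symmetric])
      then have "indicator {a..p} (p * w) = (indicator S (p, w) :: ennreal)"
        using True by (auto simp: S_def indicator_def)
      \<comment> \<open>One factor \<open>p\<close> each from the substitution, the weight
        \<open>p\<close>, the weight \<open>q = p * w\<close> and the homogeneous root.\<close>
      moreover have "ennreal \<bar>p\<bar> * ennreal (p * (p * w) * (p * ?D w)) = ennreal (p ^ 4 * (w * ?D w))"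
        using p by (subst ennreal_mult'[symmetric]) (simp_all add: power4_eq_xxxx mult_ac)
      ultimately show "ennreal \<bar>p\<bar> * (ennreal (p * (p * w) * sqrt (p\<^sup>2 + (p * w)\<^sup>2 + 2 * \<kappa> * p * (p * w))) * indicator {a..p} (p * w))
        = ennreal (p ^ 4 * (w * ?D w)) * indicator S (p, w)"
        unfolding leg_dist_scale[OF p] by (simp add: mult.assoc[symmetric])
    qed
    finally show ?thesis using True by simp
  next
    case False
    then have "indicator S (p, w) = (0 :: ennreal)" for w by (auto simp: S_def indicator_def)
    then show ?thesis using False by simp
  qed
  \<comment> \<open>For fixed \<open>w\<close> the variable \<open>p\<close> runs through
    \<open>{a / w..b}\<close>, which is empty when \<open>w < a / b\<close>.\<close>
  have inner: "(\<integral>\<^sup>+p. ennreal (p ^ 4 * (w * ?D w)) * indicator S (p, w) \<partial>lborel)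
    = ennreal ((b ^ 5 - (a / w) ^ 5) / 5 * (w * ?D w)) * indicator {a / b..1} w" if "w \<noteq> 0" for w
  proof (cases "0 < w \<and> w \<le> 1")
    case False
    have "\<not> (a / b \<le> w \<and> w \<le> 1)"
      using False that divide_nonneg_pos[OF a b] by linarith
    moreover have "indicator S (p, w) = (0 :: ennreal)" for p
      using False that by (auto simp: S_def indicator_def)
    ultimately show ?thesis by simp
  next
    case True
    have "a \<le> a / w" using True a by (simp add: field_simps mult_left_le)
    moreover have "a \<le> p * w \<longleftrightarrow> a / w \<le> p" for p using True by (simp add: field_simps)
    ultimately have "indicator S (p, w) = (indicator {a / w..b} p :: ennreal)" for p
      using True by (auto simp: S_def indicator_def)
    moreover have "ennreal (p ^ 4 * (w * ?D w)) = ennreal (p ^ 4) * ennreal (w * ?D w)" for p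
      by (rule ennreal_mult') simp
    ultimately have "(\<integral>\<^sup>+p. ennreal (p ^ 4 * (w * ?D w)) * indicator S (p, w) \<partial>lborel)
      = (\<integral>\<^sup>+p. ennreal (p ^ 4) * indicator {a / w..b} p * ennreal (w * ?D w) \<partial>lborel)"
      by (intro nn_integral_cong) (simp only: mult_ac)
    also have "\<dots> = (\<integral>\<^sup>+p\<in>{a / w..b}. ennreal (p ^ 4) \<partial>lborel) * ennreal (w * ?D w)"
      by (rule nn_integral_multc) simp
    also have "\<dots> = ennreal ((b ^ 5 - (a / w) ^ 5) / 5 * (w * ?D w)) * indicator {a / b..1} w"
    proof (cases "a / w \<le> b")
      case le: True
      then have "a / b \<le> w" using True b by (simp add: field_simps)
      moreover have "0 \<le> (b ^ 5 - (a / w) ^ 5) / 5"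
        using power_mono[OF le, of 5] True a by simp
      ultimately show ?thesis
        using True a by (simp add: nn_integral_power4_Icc[OF _ le] ennreal_mult'[symmetric] del: power_divide)
    next
      case gt: False
      then have "\<not> a / b \<le> w" using True b by (simp add: field_simps)
      with gt show ?thesis by simp
    qed
    finally show ?thesis .
  qed
  have wnn: "0 \<le> w" if "w \<in> {a / b..1}" for w
    using that divide_nonneg_pos[OF a b] by auto
  have nonneg: "0 \<le> (b ^ 5 - (a / w) ^ 5) / 5 * (w * ?D w)" if w: "w \<in> {a / b..1}" for w
  proof (cases "w = 0")
    case False
    then have "a / w \<le> b" using wnn[OF w] w b by (simp add: field_simps)
    then have "(a / w) ^ 5 \<le> b ^ 5" using wnn[OF w] a by (intro power_mono) auto
    then show ?thesis using wnn[OF w] leg_dist_pos(1)[OF k, of w] by (intro mult_nonneg_nonneg) auto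
  qed simp
  have deriv: "(F has_real_derivative (b ^ 5 - (a / w) ^ 5) / 5 * (w * ?D w)) (at w)" if w: "w \<in> {a / b..1}" for w
  \<comment> \<open>For \<open>a = 0\<close> the interval starts at 0, where \<open>1 / w\<close> is
    not differentiable; but then the term with \<open>a ^ 5\<close> is absent.\<close>
  proof (cases "a = 0")
    case True
    then have "F = (\<lambda>w. b ^ 5 * ?A w / 5)" by (simp add: F_def[abs_def])
    then show ?thesis
      using DERIV_cdivide[OF DERIV_cmult[OF DERIV_leg_primitive[OF k]], of "b ^ 5" 5 w] True by simp
  next
    case False
    then have "0 < a / b" using a b by simp
    then have wpos: "0 < w" using w by (meson atLeastAtMost_iff less_le_trans)
    have "((\<lambda>w. ?A (1 / w)) has_real_derivative (1 / w * ?D (1 / w)) * (- 1 / w\<^sup>2)) (at w)"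
      using wpos by (intro DERIV_chain2[OF DERIV_leg_primitive[OF k]])
        (auto intro!: derivative_eq_intros simp: power2_eq_square)
    moreover have "?D (1 / w) = ?D w / w"
    proof -
      have "(1 / w)\<^sup>2 + 2 * \<kappa> * (1 / w) + 1 = (w\<^sup>2 + 2 * \<kappa> * w + 1) / w\<^sup>2"
        using wpos by (simp add: field_simps power2_eq_square)
      then show ?thesis using wpos by (simp add: leg_dist_def real_sqrt_divide)
    qed
    ultimately have "((\<lambda>w. ?A (1 / w)) has_real_derivative - (?D w / w ^ 4)) (at w)"
      using wpos by (simp add: power2_eq_square power4_eq_xxxx mult.assoc)
    then have "(F has_real_derivative (b ^ 5 * (w * ?D w) + a ^ 5 * - (?D w / w ^ 4)) / 5) (at w)"
      unfolding F_def by (intro DERIV_cdivide DERIV_add DERIV_cmult DERIV_leg_primitive[OF k])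
    moreover have "(b ^ 5 * (w * ?D w) + a ^ 5 * - (?D w / w ^ 4)) / 5 = (b ^ 5 - (a / w) ^ 5) / 5 * (w * ?D w)"
    proof -
      have "(a / w) ^ 5 * w = a ^ 5 / w ^ 4"
        using wpos power_Suc[of w 4] by (simp add: power_divide)
      then have "(a / w) ^ 5 * (w * ?D w) = a ^ 5 * (?D w / w ^ 4)"
        by (metis mult.assoc times_divide_eq_left times_divide_eq_right)
      then show ?thesis by (simp add: algebra_simps)
    qed
    ultimately show ?thesis by (simp only:)
  qed
  have val: "2 * (F 1 - F (a / b)) = 2 / 5 * (b ^ 5 * (?A 1 - ?A (a / b)) - a ^ 5 * (?A (b / a) - ?A 1))"
  proof -
    have "F 1 = (b ^ 5 * ?A 1 + a ^ 5 * ?A 1) / 5" "F (a / b) = (b ^ 5 * ?A (a / b) + a ^ 5 * ?A (b / a)) / 5"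
      by (simp_all add: F_def)
    then show ?thesis by (simp only: right_diff_distrib add_divide_distrib) simp
  qed
  have "(\<integral>\<^sup>+p\<in>{a..b}. (\<integral>\<^sup>+q\<in>{a..b}. ennreal (p * q * sqrt (p\<^sup>2 + q\<^sup>2 + 2 * \<kappa> * p * q)) \<partial>lborel) \<partial>lborel)
    = 2 * (\<integral>\<^sup>+p\<in>{a..b}. (\<integral>\<^sup>+q\<in>{a..p}. ennreal (p * q * sqrt (p\<^sup>2 + q\<^sup>2 + 2 * \<kappa> * p * q)) \<partial>lborel) \<partial>lborel)"
    by (rule nn_integral_square_symmetric) (simp_all add: borel_prod[symmetric] case_prod_unfold ac_simps)
  also have "(\<integral>\<^sup>+p\<in>{a..b}. (\<integral>\<^sup>+q\<in>{a..p}. ennreal (p * q * sqrt (p\<^sup>2 + q\<^sup>2 + 2 * \<kappa> * p * q)) \<partial>lborel) \<partial>lborel)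
    = (\<integral>\<^sup>+p. \<integral>\<^sup>+w. ennreal (p ^ 4 * (w * ?D w)) * indicator S (p, w) \<partial>lborel \<partial>lborel)"
  proof (rule nn_integral_cong_AE)
    show "AE p in lborel. (\<integral>\<^sup>+q\<in>{a..p}. ennreal (p * q * sqrt (p\<^sup>2 + q\<^sup>2 + 2 * \<kappa> * p * q)) \<partial>lborel) * indicator {a..b} p
      = (\<integral>\<^sup>+w. ennreal (p ^ 4 * (w * ?D w)) * indicator S (p, w) \<partial>lborel)"
      using AE_lborel_singleton[of "0::real"] by eventually_elim (rule lower)
  qed
  also have "\<dots> = (\<integral>\<^sup>+w. \<integral>\<^sup>+p. ennreal (p ^ 4 * (w * ?D w)) * indicator S (p, w) \<partial>lborel \<partial>lborel)"
    by (rule nn_integral_lborel_swap) (simp add: borel_prod[symmetric] case_prod_unfold)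
  also have "\<dots> = (\<integral>\<^sup>+w\<in>{a / b..1}. ennreal ((b ^ 5 - (a / w) ^ 5) / 5 * (w * ?D w)) \<partial>lborel)"
  proof (rule nn_integral_cong_AE)
    show "AE w in lborel. (\<integral>\<^sup>+p. ennreal (p ^ 4 * (w * ?D w)) * indicator S (p, w) \<partial>lborel)
      = ennreal ((b ^ 5 - (a / w) ^ 5) / 5 * (w * ?D w)) * indicator {a / b..1} w"
      using AE_lborel_singleton[of "0::real"] by eventually_elim (rule inner)
  qed
  also have "\<dots> = ennreal (F 1 - F (a / b))"
    by (rule nn_integral_FTC_Icc) (use deriv nonneg ab b in simp_all)
  also have "2 * ennreal (F 1 - F (a / b)) = ennreal (2 * (F 1 - F (a / b)))"
    by (subst ennreal_mult') simp_all
  finally show "(\<integral>\<^sup>+p\<in>{a..b}. (\<integral>\<^sup>+q\<in>{a..b}. ennreal (p * q * sqrt (p\<^sup>2 + q\<^sup>2 + 2 * \<kappa> * p * q)) \<partial>lborel) \<partial>lborel)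
    = ennreal (2 / 5 * (b ^ 5 * (?A 1 - ?A (a / b)) - a ^ 5 * (?A (b / a) - ?A 1)))"
    unfolding val .
  have "F (a / b) \<le> F 1"
  proof (rule DERIV_nonneg_imp_nondecreasing[of "a / b" 1 F])
    fix w :: real assume "a / b \<le> w" "w \<le> 1"
    then show "\<exists>y. DERIV F w :> y \<and> 0 \<le> y" using deriv[of w] nonneg[of w] by auto
  qed (use ab b in simp)
  then show "0 \<le> 2 / 5 * (b ^ 5 * (?A 1 - ?A (a / b)) - a ^ 5 * (?A (b / a) - ?A 1))"
    unfolding val[symmetric] by simp
qed

text \<open>A primitive of \<open>(1 - w) * sqrt (w\<^sup>2 + \<delta>\<^sup>2)\<close>: the
  standard integral of the root, minus a cube for the part with factor \<open>w\<close>. It belongs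
  to two unit segments facing each other at distance \<open>\<delta>\<close>.\<close>

definition parallel_primitive :: "real \<Rightarrow> real \<Rightarrow> real" where
  "parallel_primitive \<delta> w = (w * sqrt (w\<^sup>2 + \<delta>\<^sup>2) + \<delta>\<^sup>2 * ln (w + sqrt (w\<^sup>2 + \<delta>\<^sup>2))) / 2
    - sqrt (w\<^sup>2 + \<delta>\<^sup>2) ^ 3 / 3"

lemma DERIV_parallel_primitive:
  assumes d: "0 < \<delta>"
  shows "(parallel_primitive \<delta> has_real_derivative (1 - w) * sqrt (w\<^sup>2 + \<delta>\<^sup>2)) (at w)"
proof -
  define D where "D = sqrt (w\<^sup>2 + \<delta>\<^sup>2)"
  have pos: "0 < w\<^sup>2 + \<delta>\<^sup>2" using d by (simp add: add_nonneg_pos)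
  have "\<bar>w\<bar> < D" unfolding D_def by (rule real_less_rsqrt) (use d in simp)
  then have D: "0 < D" "0 < w + D" by linarith+
  have D2: "D\<^sup>2 = w\<^sup>2 + \<delta>\<^sup>2" using pos by (simp add: D_def)
  have D': "((\<lambda>w. sqrt (w\<^sup>2 + \<delta>\<^sup>2)) has_real_derivative w / D) (at w)"
    using pos unfolding D_def by (auto intro!: derivative_eq_intros simp: field_simps)
  have ln': "((\<lambda>w. ln (w + sqrt (w\<^sup>2 + \<delta>\<^sup>2))) has_real_derivative 1 / (w + sqrt (w\<^sup>2 + \<delta>\<^sup>2)) * (1 + w / D)) (at w)"
    using D by (intro DERIV_chain2[OF DERIV_ln_divide DERIV_add[OF DERIV_ident D']]) (simp add: D_def)
  have log: "1 / (w + D) * (1 + w / D) = 1 / D" using D by (simp add: field_simps)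
  have e1: "w / D * w + \<delta>\<^sup>2 * (1 / D) = D"
    using D(1) D2 by (simp add: field_simps power2_eq_square)
  have e2: "of_nat 3 * (w / D * D ^ (3 - Suc 0)) / 3 = D * w"
    using D(1) by (simp add: power2_eq_square)
  have "((\<lambda>w. parallel_primitive \<delta> w) has_real_derivative (1 - w) * D) (at w)"
    unfolding parallel_primitive_def
  proof (rule DERIV_cong[OF DERIV_diff[OF DERIV_cdivide[OF DERIV_add[OF DERIV_mult[OF DERIV_ident D'] DERIV_cmult[OF ln', of "\<delta>\<^sup>2"]], of 2]
      DERIV_cdivide[OF DERIV_power[OF D', of 3], of 3]]])
    show "(1 * sqrt (w\<^sup>2 + \<delta>\<^sup>2) + w / D * w + \<delta>\<^sup>2 * (1 / (w + sqrt (w\<^sup>2 + \<delta>\<^sup>2)) * (1 + w / D))) / 2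
      - of_nat 3 * (w / D * sqrt (w\<^sup>2 + \<delta>\<^sup>2) ^ (3 - Suc 0)) / 3 = (1 - w) * D"
      unfolding D_def[symmetric] log e2 using e1 by (simp add: algebra_simps)
  qed
  then show ?thesis by (simp add: D_def)
qed

lemma parallel_primitive_mono:
  assumes "0 < \<delta>"
  shows "parallel_primitive \<delta> 0 \<le> parallel_primitive \<delta> 1"
proof (rule DERIV_nonneg_imp_nondecreasing[of 0 1 "parallel_primitive \<delta>"])
  fix w :: real assume "0 \<le> w" "w \<le> 1"
  then show "\<exists>y. DERIV (parallel_primitive \<delta>) w :> y \<and> 0 \<le> y"
    using DERIV_parallel_primitive[OF assms, of w] by (intro exI[of _ "(1 - w) * sqrt (w\<^sup>2 + \<delta>\<^sup>2)"]) simp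
qed simp

text \<open>The integrand depends only on \<open>w = p - q\<close>. Below the diagonal a given
  \<open>w\<close> occurs for \<open>p\<close> in \<open>{w..1}\<close>, whence the weight
  \<open>1 - w\<close>.\<close>

lemma nn_integral_parallel_square:
  assumes d: "0 < \<delta>"
  shows "(\<integral>\<^sup>+p\<in>{0..1}. (\<integral>\<^sup>+q\<in>{0..1}. ennreal (sqrt ((p - q)\<^sup>2 + \<delta>\<^sup>2)) \<partial>lborel) \<partial>lborel)
    = ennreal (2 * (parallel_primitive \<delta> 1 - parallel_primitive \<delta> 0))"
proof -
  let ?D = "\<lambda>w. sqrt (w\<^sup>2 + \<delta>\<^sup>2)"
  define S where "S = {(p, w). 0 \<le> w \<and> w \<le> p \<and> p \<le> (1::real)}"
  have "S = {z \<in> space (borel \<Otimes>\<^sub>M borel). 0 \<le> snd z \<and> snd z \<le> fst z \<and> fst z \<le> 1}"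
    by (auto simp: S_def space_pair_measure)
  then have [measurable]: "S \<in> sets (borel \<Otimes>\<^sub>M borel)" by simp
  have "(\<integral>\<^sup>+p\<in>{0..1}. (\<integral>\<^sup>+q\<in>{0..1}. ennreal (?D (p - q)) \<partial>lborel) \<partial>lborel)
    = 2 * (\<integral>\<^sup>+p\<in>{0..1}. (\<integral>\<^sup>+q\<in>{0..p}. ennreal (?D (p - q)) \<partial>lborel) \<partial>lborel)"
    by (rule nn_integral_square_symmetric)
      (simp_all add: borel_prod[symmetric] case_prod_unfold power2_commute)
  also have "(\<integral>\<^sup>+p\<in>{0..1}. (\<integral>\<^sup>+q\<in>{0..p}. ennreal (?D (p - q)) \<partial>lborel) \<partial>lborel)
    = (\<integral>\<^sup>+p. \<integral>\<^sup>+w. ennreal (?D w) * indicator S (p, w) \<partial>lborel \<partial>lborel)"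
  proof (rule nn_integral_cong)
    fix p :: real
    have "(\<integral>\<^sup>+q\<in>{0..p}. ennreal (?D (p - q)) \<partial>lborel)
      = ennreal \<bar>- 1\<bar> * (\<integral>\<^sup>+w. ennreal (?D (p - (p + (- 1) * w))) * indicator {0..p} (p + (- 1) * w) \<partial>lborel)"
      by (rule nn_integral_real_affine) simp_all
    also have "\<dots> = (\<integral>\<^sup>+w. ennreal (?D w) * indicator {0..p} w \<partial>lborel)"
      by (auto intro!: nn_integral_cong simp: indicator_def)
    finally have eq: "(\<integral>\<^sup>+q\<in>{0..p}. ennreal (?D (p - q)) \<partial>lborel) = (\<integral>\<^sup>+w\<in>{0..p}. ennreal (?D w) \<partial>lborel)" .
    have "indicator S (p, w) = (indicator {0..p} w * indicator {0..1} p :: ennreal)" for w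
      by (auto simp: S_def indicator_def)
    then show "(\<integral>\<^sup>+q\<in>{0..p}. ennreal (?D (p - q)) \<partial>lborel) * indicator {0..1} p
      = (\<integral>\<^sup>+w. ennreal (?D w) * indicator S (p, w) \<partial>lborel)"
      unfolding eq by (subst nn_integral_multc[symmetric]) (simp_all add: mult.assoc)
  qed
  also have "\<dots> = (\<integral>\<^sup>+w. \<integral>\<^sup>+p. ennreal (?D w) * indicator S (p, w) \<partial>lborel \<partial>lborel)"
    by (rule nn_integral_lborel_swap) (simp add: borel_prod[symmetric] case_prod_unfold)
  also have "\<dots> = (\<integral>\<^sup>+w\<in>{0..1}. ennreal ((1 - w) * ?D w) \<partial>lborel)"
  proof (rule nn_integral_cong)
    fix w :: real
    show "(\<integral>\<^sup>+p. ennreal (?D w) * indicator S (p, w) \<partial>lborel) = ennreal ((1 - w) * ?D w) * indicator {0..1} w"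
    proof (cases "w \<in> {0..1}")
      case True
      then have "(\<integral>\<^sup>+p. ennreal (?D w) * indicator S (p, w) \<partial>lborel) = (\<integral>\<^sup>+p. ennreal (?D w) * indicator {w..1} p \<partial>lborel)"
        by (intro nn_integral_cong) (auto simp: S_def indicator_def)
      also have "\<dots> = ennreal ((1 - w) * ?D w)"
        using True by (subst nn_integral_cmult_indicator) (auto simp: ennreal_mult mult.commute)
      finally show ?thesis using True by simp
    next
      case False
      then have "indicator S (p, w) = (0 :: ennreal)" for p by (auto simp: S_def indicator_def)
      then show ?thesis using False by simp
    qed
  qed
  also have "\<dots> = ennreal (parallel_primitive \<delta> 1 - parallel_primitive \<delta> 0)"
    by (rule nn_integral_FTC_Icc) (use DERIV_parallel_primitive[OF d] in auto)
  finally show ?thesis by (subst ennreal_mult') simp_all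
qed

section \<open>The regular decagon\<close>

lemma nn_integral_unit_shift:
  fixes a :: real
  assumes [measurable]: "f \<in> borel_measurable borel"
  shows "(\<integral>\<^sup>+t\<in>{0..1}. f (a + t) \<partial>lborel) = (\<integral>\<^sup>+p\<in>{a..a + 1}. f p \<partial>lborel)"
    and "(\<integral>\<^sup>+t\<in>{0..1}. f (a + 1 - t) \<partial>lborel) = (\<integral>\<^sup>+p\<in>{a..a + 1}. f p \<partial>lborel)"
proof -
  let ?g = "\<lambda>p. f p * indicator {a..a + 1} p"
  have "(\<integral>\<^sup>+p. ?g p \<partial>lborel) = (\<integral>\<^sup>+t. ?g (a + 1 * t) \<partial>lborel)"
    using nn_integral_real_affine[of ?g 1 a] by simp
  also have "\<dots> = (\<integral>\<^sup>+t\<in>{0..1}. f (a + t) \<partial>lborel)"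
    by (intro nn_integral_cong) (auto simp: indicator_def)
  finally show "(\<integral>\<^sup>+t\<in>{0..1}. f (a + t) \<partial>lborel) = (\<integral>\<^sup>+p\<in>{a..a + 1}. f p \<partial>lborel)" ..
  have "(\<integral>\<^sup>+p. ?g p \<partial>lborel) = (\<integral>\<^sup>+t. ?g (a + 1 + - 1 * t) \<partial>lborel)"
    using nn_integral_real_affine[of ?g "-1" "a + 1"] by simp
  also have "\<dots> = (\<integral>\<^sup>+t\<in>{0..1}. f (a + 1 - t) \<partial>lborel)"
    by (intro nn_integral_cong) (auto simp: indicator_def)
  finally show "(\<integral>\<^sup>+t\<in>{0..1}. f (a + 1 - t) \<partial>lborel) = (\<integral>\<^sup>+p\<in>{a..a + 1}. f p \<partial>lborel)" ..
qed

text \<open>The double integral for two unit segments that begin at distance \<open>a\<close> from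
  the intersection of their lines. At \<open>a = 0\<close> the quotient \<open>(a + 1) / a\<close>
  is 0 by convention, and the factor \<open>a ^ 5\<close> removes its term.\<close>

definition leg_value :: "real \<Rightarrow> real \<Rightarrow> real" where
  "leg_value \<kappa> a = 2 / 5 * ((a + 1) ^ 5 * (leg_primitive \<kappa> 1 - leg_primitive \<kappa> (a / (a + 1)))
    - a ^ 5 * (leg_primitive \<kappa> ((a + 1) / a) - leg_primitive \<kappa> 1))"

text \<open>The first edge is traversed towards the intersection of the lines and the second away
  from it, hence \<open>a + 1 - t\<close> against \<open>a + s\<close>.\<close>

lemma nn_integral_leg_unit:
  assumes "\<bar>\<kappa>\<bar> < 1" "0 \<le> a" "0 \<le> C"
  shows "(\<integral>\<^sup>+t\<in>{0..1}. (\<integral>\<^sup>+s\<in>{0..1}. ennreal (C * ((a + 1 - t) * (a + s) *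
      sqrt ((a + 1 - t)\<^sup>2 + (a + s)\<^sup>2 + 2 * \<kappa> * (a + 1 - t) * (a + s)))) \<partial>lborel) \<partial>lborel)
    = ennreal (C * leg_value \<kappa> a)"
proof -
  let ?h = "\<lambda>p q. ennreal (p * q * sqrt (p\<^sup>2 + q\<^sup>2 + 2 * \<kappa> * p * q))"
  have "(\<integral>\<^sup>+s\<in>{0..1}. ennreal (C * (p * (a + s) * sqrt (p\<^sup>2 + (a + s)\<^sup>2 + 2 * \<kappa> * p * (a + s)))) \<partial>lborel)
      = ennreal C * (\<integral>\<^sup>+q\<in>{a..a + 1}. ?h p q \<partial>lborel)" for p
    by (subst nn_integral_unit_shift(1)[of "?h p", symmetric])
      (simp_all add: ennreal_mult'[OF assms(3)] mult.assoc nn_integral_cmult)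
  then have "(\<integral>\<^sup>+t\<in>{0..1}. (\<integral>\<^sup>+s\<in>{0..1}. ennreal (C * ((a + 1 - t) * (a + s) *
      sqrt ((a + 1 - t)\<^sup>2 + (a + s)\<^sup>2 + 2 * \<kappa> * (a + 1 - t) * (a + s)))) \<partial>lborel) \<partial>lborel)
    = (\<integral>\<^sup>+t\<in>{0..1}. ennreal C * (\<integral>\<^sup>+q\<in>{a..a + 1}. ?h (a + 1 - t) q \<partial>lborel) \<partial>lborel)"
    by simp
  also have "\<dots> = ennreal C * (\<integral>\<^sup>+t\<in>{0..1}. (\<integral>\<^sup>+q\<in>{a..a + 1}. ?h (a + 1 - t) q \<partial>lborel) \<partial>lborel)"
    by (simp add: mult.assoc nn_integral_cmult)
  also have "(\<integral>\<^sup>+t\<in>{0..1}. (\<integral>\<^sup>+q\<in>{a..a + 1}. ?h (a + 1 - t) q \<partial>lborel) \<partial>lborel)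
    = (\<integral>\<^sup>+p\<in>{a..a + 1}. (\<integral>\<^sup>+q\<in>{a..a + 1}. ?h p q \<partial>lborel) \<partial>lborel)"
    by (rule nn_integral_unit_shift(2)) simp
  also have "\<dots> = ennreal (leg_value \<kappa> a)"
    unfolding leg_value_def by (rule nn_integral_leg_square(1)) (use assms in auto)
  finally show ?thesis by (simp add: ennreal_mult'[OF assms(3)])
qed

lemma leg_value_nonneg:
  assumes "\<bar>\<kappa>\<bar> < 1" "0 \<le> a"
  shows "0 \<le> leg_value \<kappa> a"
  unfolding leg_value_def by (rule nn_integral_leg_square(2)) (use assms in auto)

section \<open>Arithmetic in the field generated by the golden ratio and the sine of 36
  degrees\<close>

locale golden_ratio =
  fixes \<phi> S :: real
  assumes phi_def: "\<phi> = (1 + sqrt 5) / 2" and S_def: "S = sin (pi / 5)"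
begin

lemma phi_sq: "\<phi> * \<phi> = \<phi> + 1"
proof -
  have "sqrt 5 * sqrt 5 = (5::real)" by simp
  then show ?thesis by (simp add: phi_def field_simps)
qed

lemma phi_gt_1: "1 < \<phi>"
  using real_less_rsqrt[of 1 5] by (simp add: phi_def)

lemma phi_less_2: "\<phi> < 2"
  using real_less_lsqrt[of 3 5] by (simp add: phi_def)

lemma sqrt_5_eq: "sqrt 5 = 2 * \<phi> - 1"
  by (simp add: phi_def field_simps)

text \<open>Since 3 pi / 5 and 2 pi / 5 are supplementary, the cosine satisfies a cubic that splits
  into \<open>c + 1\<close> and a quadratic; \<open>1 / 2 < c\<close> selects the root.\<close>

lemma cos_36: "cos (pi / 5) = \<phi> / 2"
proof -
  define c where "c = cos (pi / 5)"
  have "cos (3 * (pi / 5)) = - cos (2 * (pi / 5))"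
    using cos_pi_minus[of "2 * (pi / 5)"] by (simp add: field_simps)
  then have "4 * c ^ 3 - 3 * c = - (2 * c\<^sup>2 - 1)"
    unfolding cos_treble_cos cos_double_cos by (simp add: c_def)
  then have "(c + 1) * ((4 * c - 1)\<^sup>2 - 5) = 0"
    by (simp add: power2_eq_square power3_eq_cube algebra_simps)
  moreover have "1 / 2 < c"
    using cos_monotone_0_pi[of "pi / 5" "pi / 3"] by (simp add: c_def cos_60)
  ultimately have "(4 * c - 1)\<^sup>2 = 5" "0 \<le> 4 * c - 1" by auto
  then have "sqrt 5 = 4 * c - 1" by (metis real_sqrt_unique)
  then show ?thesis by (simp add: phi_def c_def)
qed

lemma S_pos: "0 < S"
  unfolding S_def by (rule sin_gt_zero) (auto simp: field_simps)

lemma S_sq: "S * S = 3 / 4 - \<phi> / 4"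
proof -
  have "S * S = 1 - (\<phi> / 2)\<^sup>2"
    using sin_cos_squared_add[of "pi / 5"] unfolding cos_36 by (simp add: S_def power2_eq_square)
  then show ?thesis by (simp add: power2_eq_square phi_sq field_simps)
qed

lemma phi_sq': "\<phi> * (\<phi> * x) = \<phi> * x + x"
  unfolding mult.assoc[symmetric] phi_sq by (simp add: distrib_right)

lemma S_sq': "S * (S * x) = 3 / 4 * x - \<phi> * x / 4"
  unfolding mult.assoc[symmetric] S_sq by (simp add: left_diff_distrib)

text \<open>Brings polynomials to rational combinations of 1, \<open>\<phi>\<close>,
  \<open>S\<close> and \<open>\<phi> * S\<close>. The primed rules repeat the reductions inside
  right-nested products.\<close>

lemmas golden_simps = algebra_simps phi_sq S_sq phi_sq' S_sq'

definition unit_vertex :: "nat \<Rightarrow> complex" where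
  "unit_vertex k = cis (2 * pi * real k / 10)"

lemma unit_vertex_add: "unit_vertex (j + k) = unit_vertex j * unit_vertex k"
  by (simp add: unit_vertex_def cis_mult add_divide_distrib distrib_left)

text \<open>Indices up to 6 suffice: relative to edge 0, an edge at most five steps ahead ends at
  vertex 6 at the latest.\<close>

lemma unit_vertex_table:
  "unit_vertex 0 = 1"
  "unit_vertex (Suc 0) = Complex (\<phi> / 2) S"
  "unit_vertex 1 = Complex (\<phi> / 2) S"
  "unit_vertex 2 = Complex ((\<phi> - 1) / 2) (\<phi> * S)"
  "unit_vertex 3 = Complex ((1 - \<phi>) / 2) (\<phi> * S)"
  "unit_vertex 4 = Complex (- \<phi> / 2) S"
  "unit_vertex 5 = - 1"
  "unit_vertex 6 = Complex (- \<phi> / 2) (- S)"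
proof -
  show 0: "unit_vertex 0 = 1" by (simp add: unit_vertex_def)
  show 1: "unit_vertex 1 = Complex (\<phi> / 2) S"
    using cos_36 by (simp add: unit_vertex_def complex_eq_iff S_def)
  then show "unit_vertex (Suc 0) = Complex (\<phi> / 2) S" by simp
  have "unit_vertex (1 + 1) = unit_vertex 1 * unit_vertex 1" by (rule unit_vertex_add)
  then show 2: "unit_vertex 2 = Complex ((\<phi> - 1) / 2) (\<phi> * S)"
    unfolding 1 one_add_one by (simp add: complex_eq_iff golden_simps add_divide_distrib diff_divide_distrib)
  have "unit_vertex (2 + 1) = unit_vertex 2 * unit_vertex 1" by (rule unit_vertex_add)
  then have "unit_vertex 3 = unit_vertex 2 * unit_vertex 1" by (simp del: One_nat_def)
  then show 3: "unit_vertex 3 = Complex ((1 - \<phi>) / 2) (\<phi> * S)"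
    unfolding 1 2 by (simp add: complex_eq_iff golden_simps add_divide_distrib diff_divide_distrib)
  have "unit_vertex (2 + 2) = unit_vertex 2 * unit_vertex 2" by (rule unit_vertex_add)
  then have "unit_vertex 4 = unit_vertex 2 * unit_vertex 2" by simp
  then show 4: "unit_vertex 4 = Complex (- \<phi> / 2) S"
    unfolding 2 by (simp add: complex_eq_iff golden_simps add_divide_distrib diff_divide_distrib)
  show 5: "unit_vertex 5 = - 1"
    by (simp add: unit_vertex_def)
  have "unit_vertex (5 + 1) = unit_vertex 5 * unit_vertex 1" by (rule unit_vertex_add)
  then have "unit_vertex 6 = unit_vertex 5 * unit_vertex 1" by (simp del: One_nat_def)
  then show 6: "unit_vertex 6 = Complex (- \<phi> / 2) (- S)"
    unfolding 1 5 by (simp add: complex_eq_iff)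
qed

end

section \<open>Strict convexity of the decagon\<close>

lemma Im_of_real_mult: "Im (of_real a * z) = a * Im z"
  by simp

text \<open>Twice the signed area of a triangle inscribed in the unit circle, in terms of half its
  central angles. Unlike the expanded form, the product shows the sign.\<close>

lemma Im_cnj_cis_diff_mult:
  "Im (cnj (cis a - cis c) * (cis b - cis c)) = 4 * sin ((b - a) / 2) * sin ((c - a) / 2) * sin ((c - b) / 2)"
proof -
  define x y where "x = (b - a) / 2" and "y = (c - a) / 2"
  have xy: "b - a = 2 * x" "c - a = 2 * y" "b - c = 2 * x - 2 * y" "(c - b) / 2 = y - x"
    by (simp_all add: x_def y_def field_simps)
  have "Im (cnj (cis a - cis c) * (cis b - cis c)) = sin (b - a) - sin (c - a) - sin (b - c)"
    by (simp add: sin_diff algebra_simps)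
  also have "\<dots> = 2 * sin x * cos x * (1 - cos (2 * y)) - 2 * sin y * cos y * (1 - cos (2 * x))"
    unfolding xy sin_diff[of "2 * x" "2 * y"] sin_double by (simp add: algebra_simps)
  also have "\<dots> = 4 * sin x * sin y * sin (y - x)"
    unfolding cos_double_sin sin_diff by (simp add: power2_eq_square algebra_simps)
  finally show ?thesis unfolding xy(4) by (simp add: x_def y_def)
qed

lemma convex_polygon_decagon:
  assumes "0 < r"
  shows "convex_polygon 10 (\<lambda>k. of_real r * cis (2 * pi * real k / 10))"
proof
  fix i :: nat
  have "2 * pi * real (i + 10) / 10 = 2 * pi * real i / 10 + 2 * pi" by (simp add: algebra_simps)
  then show "of_real r * cis (2 * pi * real (i + 10) / 10) = of_real r * cis (2 * pi * real i / 10)"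
    by (simp only: cis_mult[symmetric] cis_2pi mult_1_right)
next
  fix i j :: nat
  assume ij: "i < 10" "j < 10" "j \<noteq> i" "j \<noteq> Suc i mod 10"
  define d where "d = pi * (real j - real i) / 10"
  let ?c = "\<lambda>k. cis (2 * pi * real k / 10)"
  have ang: "(2 * pi * real (Suc i) / 10 - 2 * pi * real i / 10) / 2 = pi / 10"
    "(2 * pi * real j / 10 - 2 * pi * real i / 10) / 2 = d"
    "(2 * pi * real j / 10 - 2 * pi * real (Suc i) / 10) / 2 = d - pi / 10"
    by (simp_all add: d_def field_simps)
  \<comment> \<open>\<open>d\<close> is half of the angle from vertex \<open>i\<close> to vertex
    \<open>j\<close>, and \<open>pi / 10\<close> is half of the angle of edge \<open>i\<close>. As
    \<open>j\<close> is not an endpoint of the edge, \<open>d\<close> and \<open>d - pi / 10\<close>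
    lie both in (0, pi) or both in (-pi, 0).\<close>
  have "0 < sin d * sin (d - pi / 10)"
  proof (cases "i < j")
    case True
    then have "i + 2 \<le> j" using ij by (auto simp: mod_Suc split: if_splits)
    then have "real i + 2 \<le> real j" "real j < real i + 10" using ij by linarith+
    then have "pi * 2 \<le> pi * (real j - real i)" "pi * (real j - real i) < pi * 10" by simp_all
    then have "2 * pi / 10 \<le> d" "d < pi" by (simp_all add: d_def)
    then have "0 < sin d" "0 < sin (d - pi / 10)"
      using pi_gt_zero by - (rule sin_gt_zero, linarith, linarith)+
    then show ?thesis by simp
  next
    case False
    \<comment> \<open>The bound 9 excludes \<open>i = 9\<close>, \<open>j = 0\<close>, where the
      next vertex wraps around.\<close>
    then have "j < i" "i - j < 9" using ij by (auto simp: mod_Suc split: if_splits)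
    then have "real i - real j < 9" "real j - real i < 0" by linarith+
    then have "pi * (real i - real j) < pi * 9" "pi * (real j - real i) < 0"
      by (simp_all add: mult_pos_neg)
    moreover have d10: "pi * (real j - real i) = d * 10" by (simp add: d_def)
    moreover have "pi * (real i - real j) = - (d * 10)"
      unfolding d10[symmetric] by (simp add: algebra_simps)
    ultimately have "0 < - d" "- d + pi / 10 < pi" by linarith+
    then have "0 < sin (- d)" "0 < sin (- d + pi / 10)"
      using pi_gt_zero by - (rule sin_gt_zero, linarith, linarith)+
    then have "0 < sin (- d) * sin (- d + pi / 10)" by (rule mult_pos_pos)
    also have "- d + pi / 10 = - (d - pi / 10)" by simp
    finally show ?thesis unfolding sin_minus by simp
  qed
  moreover have "0 < 4 * sin (pi / 10)" using sin_gt_zero[of "pi / 10"] by simp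
  ultimately have "0 < 4 * sin (pi / 10) * (sin d * sin (d - pi / 10))"
    by (rule mult_pos_pos[rotated])
  then have "0 < Im (cnj (?c i - ?c j) * (?c (Suc i) - ?c j))"
    unfolding Im_cnj_cis_diff_mult ang by (simp only: mult.assoc)
  then have "0 < (r * r) * Im (cnj (?c i - ?c j) * (?c (Suc i) - ?c j))"
    using assms by simp
  also have "\<dots> = Im (of_real (r * r) * (cnj (?c i - ?c j) * (?c (Suc i) - ?c j)))"
    by (rule Im_of_real_mult[symmetric])
  also have "of_real (r * r) * (cnj (?c i - ?c j) * (?c (Suc i) - ?c j))
    = cnj (of_real r * ?c i - of_real r * ?c j) * (of_real r * ?c (Suc i) - of_real r * ?c j)"
    by (simp only: right_diff_distrib[symmetric] complex_cnj_mult complex_cnj_complex_of_real of_real_mult mult_ac)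
  finally show "0 < Im (cnj (of_real r * ?c i - of_real r * ?c j) * (of_real r * ?c (Suc i) - of_real r * ?c j))" .
qed simp

section \<open>Symmetries of the integrals over pairs of edges\<close>

context convex_polygon
begin

definition edge_pair_integral :: "nat \<Rightarrow> nat \<Rightarrow> ennreal" where
  "edge_pair_integral i j = (\<integral>\<^sup>+t\<in>{0..1}. (\<integral>\<^sup>+s\<in>{0..1}.
    ennreal (height i (edge j t) * height j (edge i s) * dist (edge j t) (edge i s)) \<partial>lborel) \<partial>lborel)"

lemma edge_pair_integral_self: "edge_pair_integral i i = 0"
  by (simp add: edge_pair_integral_def height_edge)

lemma edge_pair_integral_cong:
  assumes "i mod n = i' mod n"
  shows "edge_pair_integral i j = edge_pair_integral i' j"
proof -
  have "Suc i mod n = Suc i' mod n" using assms by (metis mod_Suc_eq)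
  then have "edge i = edge i'"
    using vertex_cong[OF assms] vertex_cong[of "Suc i" "Suc i'"] by (simp add: edge_def[abs_def])
  then show ?thesis by (simp add: edge_pair_integral_def height_cong[OF assms])
qed

lemma edge_pair_integral_commute: "edge_pair_integral i j = edge_pair_integral j i"
proof -
  let ?f = "\<lambda>t s. ennreal (height i (edge j t) * height j (edge i s) * dist (edge j t) (edge i s)) * indicator {0..1} s * indicator {0..1} t"
  have "edge_pair_integral i j = (\<integral>\<^sup>+t. \<integral>\<^sup>+s. ?f t s \<partial>lborel \<partial>lborel)"
    unfolding edge_pair_integral_def by (intro nn_integral_cong nn_integral_multc[symmetric]) measurable
  also have "\<dots> = (\<integral>\<^sup>+s. \<integral>\<^sup>+t. ?f t s \<partial>lborel \<partial>lborel)"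
    by (rule nn_integral_lborel_swap) (simp add: borel_prod[symmetric] case_prod_unfold)
  also have "\<dots> = (\<integral>\<^sup>+s. \<integral>\<^sup>+t. ennreal (height j (edge i s) * height i (edge j t) * dist (edge i s) (edge j t)) * indicator {0..1} t * indicator {0..1} s \<partial>lborel \<partial>lborel)"
    by (intro nn_integral_cong) (simp add: dist_commute mult_ac)
  also have "\<dots> = edge_pair_integral j i"
    unfolding edge_pair_integral_def by (intro nn_integral_cong nn_integral_multc) measurable
  finally show ?thesis .
qed

end

section \<open>The classes of edge pairs in the decagon\<close>

locale decagon = golden_ratio +
  fixes r :: real
  assumes r_pos: "0 < r"
begin

definition vertex :: "nat \<Rightarrow> complex" where
  "vertex k = of_real r * unit_vertex k"

sublocale convex_polygon 10 vertex
  unfolding vertex_def[abs_def] unit_vertex_def by (rule convex_polygon_decagon[OF r_pos])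

definition unit_height :: "nat \<Rightarrow> nat \<Rightarrow> real" where
  "unit_height k l = Im (cnj (unit_vertex k - unit_vertex l) * (unit_vertex (Suc k) - unit_vertex l))"

lemma vertex_diff_rotate:
  "vertex (j + k) - vertex (j + l) = of_real r * unit_vertex j * (unit_vertex k - unit_vertex l)"
  by (simp add: vertex_def unit_vertex_add right_diff_distrib mult.assoc)

text \<open>Rotation and scaling multiply both differences by the same \<open>w\<close>, and
  \<open>cnj w * w\<close> is \<open>r\<^sup>2\<close>; so heights depend only on relative
  positions.\<close>

lemma height_rotate: "height (j + k) (vertex (j + l)) = r\<^sup>2 * unit_height k l"
proof -
  define w where "w = of_real r * unit_vertex j"
  have w: "cnj w * w = of_real (r\<^sup>2)"
    by (simp add: w_def unit_vertex_def cis_cnj cis_mult power2_eq_square mult_ac)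
  have "height (j + k) (vertex (j + l))
    = Im (cnj (w * (unit_vertex k - unit_vertex l)) * (w * (unit_vertex (Suc k) - unit_vertex l)))"
    unfolding height_def using vertex_diff_rotate[of j k l] vertex_diff_rotate[of j "Suc k" l] by (simp add: w_def)
  also have "cnj (w * (unit_vertex k - unit_vertex l)) * (w * (unit_vertex (Suc k) - unit_vertex l))
    = (cnj w * w) * (cnj (unit_vertex k - unit_vertex l) * (unit_vertex (Suc k) - unit_vertex l))"
    by (simp only: complex_cnj_mult mult_ac)
  also have "Im \<dots> = r\<^sup>2 * unit_height k l"
    unfolding w Im_of_real_mult unit_height_def ..
  finally show ?thesis .
qed

lemma height_edge_rotate:
  "height (j + k) (edge j t) = r\<^sup>2 * ((1 - t) * unit_height k 0 + t * unit_height k 1)"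
  "height j (edge (j + k) s) = r\<^sup>2 * ((1 - s) * unit_height 0 k + s * unit_height 0 (Suc k))"
  using height_rotate[of j k 0] height_rotate[of j k 1] height_rotate[of j 0 k] height_rotate[of j 0 "Suc k"]
  by (simp_all add: height_edge algebra_simps)

lemma dist_edge_rotate:
  "dist (edge j t) (edge (j + k) s) = r * cmod (of_real (1 - t) * unit_vertex 0 + of_real t * unit_vertex 1
    - of_real (1 - s) * unit_vertex k - of_real s * unit_vertex (Suc k))"
proof -
  have "edge j t - edge (j + k) s = of_real r * unit_vertex j * (of_real (1 - t) * unit_vertex 0 + of_real t * unit_vertex 1
    - of_real (1 - s) * unit_vertex k - of_real s * unit_vertex (Suc k))"
    using unit_vertex_add[of j 0] unit_vertex_add[of j 1] unit_vertex_add[of j k] unit_vertex_add[of j "Suc k"]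
    by (simp add: edge_def vertex_def unit_vertex_table(1) algebra_simps)
  then show ?thesis using r_pos by (simp add: dist_norm norm_mult unit_vertex_def)
qed

lemma height_center: "height i 0 = r\<^sup>2 * S"
proof -
  have "cnj (vertex i) * vertex (Suc i) = of_real (r\<^sup>2) * (cnj (unit_vertex i) * unit_vertex i * unit_vertex 1)"
    using unit_vertex_add[of i 1] by (simp add: vertex_def power2_eq_square mult_ac)
  also have "cnj (unit_vertex i) * unit_vertex i = 1"
    by (simp add: unit_vertex_def cis_cnj cis_mult)
  finally show ?thesis by (simp add: height_def unit_vertex_table)
qed

lemma height_center_pos: "0 < height i 0"
  using r_pos S_pos by (simp add: height_center)

text \<open>For \<open>k < 5\<close> the factors have a meaning: \<open>2 - \<phi>\<close> is the
  squared side, \<open>S\<close> or \<open>\<phi> * S\<close> is sin (k pi / 5), and the rest is the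
  distance, in side lengths, from the point where the two edge lines meet. For \<open>k = 5\<close>
  the lines are parallel and the height is constant.\<close>

lemma unit_height_table:
  "unit_height 1 0 = (2 - \<phi>) * S" "unit_height 1 1 = 0"
  "unit_height 0 1 = 0" "unit_height 0 2 = (2 - \<phi>) * S"
  "unit_height 2 0 = (2 - \<phi>) * (\<phi> * S) * \<phi>" "unit_height 2 1 = (2 - \<phi>) * (\<phi> * S) * (\<phi> - 1)"
  "unit_height 0 3 = (2 - \<phi>) * (\<phi> * S) * \<phi>"
  "unit_height 3 0 = (2 - \<phi>) * (\<phi> * S) * (\<phi> + 1)" "unit_height 3 1 = (2 - \<phi>) * (\<phi> * S) * \<phi>"
  "unit_height 0 4 = (2 - \<phi>) * (\<phi> * S) * (\<phi> + 1)"
  "unit_height 4 0 = (2 - \<phi>) * S * (2 * \<phi> + 2)" "unit_height 4 1 = (2 - \<phi>) * S * (2 * \<phi> + 1)"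
  "unit_height 0 5 = (2 - \<phi>) * S * (2 * \<phi> + 2)"
  "unit_height 5 0 = 2 * S" "unit_height 5 1 = 2 * S" "unit_height 0 6 = 2 * S"
  by (simp_all add: unit_height_def unit_vertex_table numeral_2_eq_2[symmetric] golden_simps add_divide_distrib diff_divide_distrib)

text \<open>The same heights, factored as needed for the next pair of edges.\<close>

lemma unit_height_table_alt:
  "unit_height 0 2 = (2 - \<phi>) * (\<phi> * S) * (\<phi> - 1)"
  "unit_height 0 3 = (2 - \<phi>) * (\<phi> * S) * \<phi>"
  "unit_height 0 4 = (2 - \<phi>) * S * (2 * \<phi> + 1)"
  "unit_height 0 5 = 2 * S"
  by (simp_all add: unit_height_def unit_vertex_table golden_simps add_divide_distrib diff_divide_distrib)

text \<open>\<open>\<kappa>\<close> and \<open>\<sigma>\<close> stand for the cosine and sine of k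
  pi / 5, \<open>a\<close> for the distance in side lengths from the intersection of the lines to
  the nearer endpoints, and \<open>\<phi> - 1\<close> is the side. Two heights and a distance give
  the fifth power of the side, here \<open>(2 - \<phi>)\<^sup>2 * (\<phi> - 1)\<close>, times
  \<open>\<sigma>\<^sup>2\<close>.\<close>

lemma edge_pair_integral_leg:
  assumes \<kappa>: "\<bar>\<kappa>\<bar> < 1" and a: "0 \<le> a"
    and h: "unit_height k 0 = (2 - \<phi>) * \<sigma> * (a + 1)" "unit_height k 1 = (2 - \<phi>) * \<sigma> * a"
      "unit_height 0 k = (2 - \<phi>) * \<sigma> * a" "unit_height 0 (Suc k) = (2 - \<phi>) * \<sigma> * (a + 1)"
    and d: "\<And>t s. (cmod (of_real (1 - t) * unit_vertex 0 + of_real t * unit_vertex 1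
        - of_real (1 - s) * unit_vertex k - of_real s * unit_vertex (Suc k)))\<^sup>2
      = (\<phi> - 1)\<^sup>2 * ((a + 1 - t)\<^sup>2 + (a + s)\<^sup>2 + 2 * \<kappa> * (a + 1 - t) * (a + s))"
  shows "edge_pair_integral (j + k) j = ennreal (r ^ 5 * ((2 - \<phi>)\<^sup>2 * (\<phi> - 1) * \<sigma>\<^sup>2 * leg_value \<kappa> a))"
proof -
  have d': "dist (edge j t) (edge (j + k) s)
      = r * ((\<phi> - 1) * sqrt ((a + 1 - t)\<^sup>2 + (a + s)\<^sup>2 + 2 * \<kappa> * (a + 1 - t) * (a + s)))" for t s
  proof -
    have "cmod (of_real (1 - t) * unit_vertex 0 + of_real t * unit_vertex 1
        - of_real (1 - s) * unit_vertex k - of_real s * unit_vertex (Suc k))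
      = sqrt ((\<phi> - 1)\<^sup>2 * ((a + 1 - t)\<^sup>2 + (a + s)\<^sup>2 + 2 * \<kappa> * (a + 1 - t) * (a + s)))"
      unfolding d[symmetric] by simp
    also have "\<dots> = (\<phi> - 1) * sqrt ((a + 1 - t)\<^sup>2 + (a + s)\<^sup>2 + 2 * \<kappa> * (a + 1 - t) * (a + s))"
      using phi_gt_1 by (subst real_sqrt_mult) simp
    finally show ?thesis unfolding dist_edge_rotate by simp
  qed
  have h1: "height (j + k) (edge j t) = r\<^sup>2 * ((2 - \<phi>) * \<sigma> * (a + 1 - t))" for t
    unfolding height_edge_rotate h by (simp add: algebra_simps)
  have h2: "height j (edge (j + k) s) = r\<^sup>2 * ((2 - \<phi>) * \<sigma> * (a + s))" for s
    unfolding height_edge_rotate h by (simp add: algebra_simps)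
  define C where "C = r ^ 5 * ((2 - \<phi>)\<^sup>2 * (\<phi> - 1) * \<sigma>\<^sup>2)"
  have C: "0 \<le> C" using r_pos phi_gt_1 by (simp add: C_def)
  have r5: "r ^ 5 = r\<^sup>2 * r\<^sup>2 * r" by (simp add: eval_nat_numeral)
  have "edge_pair_integral (j + k) j = (\<integral>\<^sup>+t\<in>{0..1}. (\<integral>\<^sup>+s\<in>{0..1}. ennreal (C * ((a + 1 - t) * (a + s) *
      sqrt ((a + 1 - t)\<^sup>2 + (a + s)\<^sup>2 + 2 * \<kappa> * (a + 1 - t) * (a + s)))) \<partial>lborel) \<partial>lborel)"
  proof -
    have "height (j + k) (edge j t) * height j (edge (j + k) s) * dist (edge j t) (edge (j + k) s)
      = C * ((a + 1 - t) * (a + s) * sqrt ((a + 1 - t)\<^sup>2 + (a + s)\<^sup>2 + 2 * \<kappa> * (a + 1 - t) * (a + s)))" for t s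
      unfolding h1 h2 d' C_def r5 power2_eq_square[of "2 - \<phi>"] power2_eq_square[of \<sigma>] by (simp only: mult_ac)
    then show ?thesis unfolding edge_pair_integral_def by simp
  qed
  also have "\<dots> = ennreal (C * leg_value \<kappa> a)" by (rule nn_integral_leg_unit[OF \<kappa> a C])
  finally show ?thesis by (simp only: C_def mult.assoc)
qed

text \<open>The directions of the edges differ by 36, 72, 108 and 144 degrees, whose cosines and
  sines are the parameters; \<open>a\<close> is found by prolonging the sides until they
  meet.\<close>

lemma edge_pair_integral_legs:
  "edge_pair_integral (j + 1) j = ennreal (r ^ 5 * ((2 - \<phi>)\<^sup>2 * (\<phi> - 1) * S\<^sup>2 * leg_value (\<phi> / 2) 0))"
  "edge_pair_integral (j + 2) j = ennreal (r ^ 5 * ((2 - \<phi>)\<^sup>2 * (\<phi> - 1) * (\<phi> * S)\<^sup>2 * leg_value ((\<phi> - 1) / 2) (\<phi> - 1)))"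
  "edge_pair_integral (j + 3) j = ennreal (r ^ 5 * ((2 - \<phi>)\<^sup>2 * (\<phi> - 1) * (\<phi> * S)\<^sup>2 * leg_value ((1 - \<phi>) / 2) \<phi>))"
  "edge_pair_integral (j + 4) j = ennreal (r ^ 5 * ((2 - \<phi>)\<^sup>2 * (\<phi> - 1) * S\<^sup>2 * leg_value (- \<phi> / 2) (2 * \<phi> + 1)))"
proof -
  note bounds = phi_gt_1 phi_less_2
  have dist_simps: "(cmod (of_real (1 - t) * Complex x0 y0 + of_real t * Complex x1 y1
      - of_real (1 - s) * Complex x2 y2 - of_real s * Complex x3 y3))\<^sup>2
    = ((1 - t) * x0 + t * x1 - (1 - s) * x2 - s * x3)\<^sup>2 + ((1 - t) * y0 + t * y1 - (1 - s) * y2 - s * y3)\<^sup>2"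
    for t s x0 x1 x2 x3 y0 y1 y2 y3
    by (simp add: cmod_power2)
  have one: "1 = Complex 1 0" by (simp add: complex_eq_iff)
  have five: "unit_vertex 5 = Complex (- 1) 0" by (simp add: unit_vertex_table complex_eq_iff)
  show "edge_pair_integral (j + 1) j = ennreal (r ^ 5 * ((2 - \<phi>)\<^sup>2 * (\<phi> - 1) * S\<^sup>2 * leg_value (\<phi> / 2) 0))"
  proof (rule edge_pair_integral_leg)
    show "\<bar>\<phi> / 2\<bar> < 1" using bounds by simp
    fix t s :: real
    have "(cmod (of_real (1 - t) * unit_vertex 0 + of_real t * unit_vertex 1
        - of_real (1 - s) * unit_vertex 1 - of_real s * unit_vertex 2))\<^sup>2
      = (\<phi> - 1)\<^sup>2 * ((0 + 1 - t)\<^sup>2 + (0 + s)\<^sup>2 + 2 * (\<phi> / 2) * (0 + 1 - t) * (0 + s))"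
      unfolding unit_vertex_table one dist_simps
      by (simp add: power2_eq_square golden_simps add_divide_distrib diff_divide_distrib)
    then show "(cmod (of_real (1 - t) * unit_vertex 0 + of_real t * unit_vertex 1
        - of_real (1 - s) * unit_vertex 1 - of_real s * unit_vertex (Suc 1)))\<^sup>2
      = (\<phi> - 1)\<^sup>2 * ((0 + 1 - t)\<^sup>2 + (0 + s)\<^sup>2 + 2 * (\<phi> / 2) * (0 + 1 - t) * (0 + s))"
      by (simp only: Suc_1)
  qed (simp_all add: unit_height_table Suc_1 del: One_nat_def)
  show "edge_pair_integral (j + 2) j = ennreal (r ^ 5 * ((2 - \<phi>)\<^sup>2 * (\<phi> - 1) * (\<phi> * S)\<^sup>2 * leg_value ((\<phi> - 1) / 2) (\<phi> - 1)))"
  proof (rule edge_pair_integral_leg)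
    show "\<bar>(\<phi> - 1) / 2\<bar> < 1" using bounds by simp
    fix t s :: real
    have "(cmod (of_real (1 - t) * unit_vertex 0 + of_real t * unit_vertex 1
        - of_real (1 - s) * unit_vertex 2 - of_real s * unit_vertex 3))\<^sup>2
      = (\<phi> - 1)\<^sup>2 * ((\<phi> - 1 + 1 - t)\<^sup>2 + (\<phi> - 1 + s)\<^sup>2 + 2 * ((\<phi> - 1) / 2) * (\<phi> - 1 + 1 - t) * (\<phi> - 1 + s))"
      unfolding unit_vertex_table one dist_simps
      by (simp add: power2_eq_square golden_simps add_divide_distrib diff_divide_distrib)
    then show "(cmod (of_real (1 - t) * unit_vertex 0 + of_real t * unit_vertex 1
        - of_real (1 - s) * unit_vertex 2 - of_real s * unit_vertex (Suc 2)))\<^sup>2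
      = (\<phi> - 1)\<^sup>2 * ((\<phi> - 1 + 1 - t)\<^sup>2 + (\<phi> - 1 + s)\<^sup>2 + 2 * ((\<phi> - 1) / 2) * (\<phi> - 1 + 1 - t) * (\<phi> - 1 + s))"
      by simp
  qed (use bounds unit_height_table(5-7) unit_height_table_alt(1) in simp_all)
  show "edge_pair_integral (j + 3) j = ennreal (r ^ 5 * ((2 - \<phi>)\<^sup>2 * (\<phi> - 1) * (\<phi> * S)\<^sup>2 * leg_value ((1 - \<phi>) / 2) \<phi>))"
  proof (rule edge_pair_integral_leg)
    show "\<bar>(1 - \<phi>) / 2\<bar> < 1" using bounds by simp
    fix t s :: real
    have "(cmod (of_real (1 - t) * unit_vertex 0 + of_real t * unit_vertex 1
        - of_real (1 - s) * unit_vertex 3 - of_real s * unit_vertex 4))\<^sup>2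
      = (\<phi> - 1)\<^sup>2 * ((\<phi> + 1 - t)\<^sup>2 + (\<phi> + s)\<^sup>2 + 2 * ((1 - \<phi>) / 2) * (\<phi> + 1 - t) * (\<phi> + s))"
      unfolding unit_vertex_table one dist_simps
      by (simp add: power2_eq_square golden_simps add_divide_distrib diff_divide_distrib)
    then show "(cmod (of_real (1 - t) * unit_vertex 0 + of_real t * unit_vertex 1
        - of_real (1 - s) * unit_vertex 3 - of_real s * unit_vertex (Suc 3)))\<^sup>2
      = (\<phi> - 1)\<^sup>2 * ((\<phi> + 1 - t)\<^sup>2 + (\<phi> + s)\<^sup>2 + 2 * ((1 - \<phi>) / 2) * (\<phi> + 1 - t) * (\<phi> + s))"
      by simp
  qed (use bounds unit_height_table(8-10) unit_height_table_alt(2) in simp_all)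
  show "edge_pair_integral (j + 4) j = ennreal (r ^ 5 * ((2 - \<phi>)\<^sup>2 * (\<phi> - 1) * S\<^sup>2 * leg_value (- \<phi> / 2) (2 * \<phi> + 1)))"
  proof (rule edge_pair_integral_leg)
    show "\<bar>- \<phi> / 2\<bar> < 1" using bounds by simp
    fix t s :: real
    have "(cmod (of_real (1 - t) * unit_vertex 0 + of_real t * unit_vertex 1
        - of_real (1 - s) * unit_vertex 4 - of_real s * unit_vertex 5))\<^sup>2
      = (\<phi> - 1)\<^sup>2 * ((2 * \<phi> + 1 + 1 - t)\<^sup>2 + (2 * \<phi> + 1 + s)\<^sup>2 + 2 * (- \<phi> / 2) * (2 * \<phi> + 1 + 1 - t) * (2 * \<phi> + 1 + s))"
      unfolding five unit_vertex_table one dist_simps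
      by (simp add: power2_eq_square golden_simps add_divide_distrib diff_divide_distrib)
    then show "(cmod (of_real (1 - t) * unit_vertex 0 + of_real t * unit_vertex 1
        - of_real (1 - s) * unit_vertex 4 - of_real s * unit_vertex (Suc 4)))\<^sup>2
      = (\<phi> - 1)\<^sup>2 * ((2 * \<phi> + 1 + 1 - t)\<^sup>2 + (2 * \<phi> + 1 + s)\<^sup>2 + 2 * (- \<phi> / 2) * (2 * \<phi> + 1 + 1 - t) * (2 * \<phi> + 1 + s))"
      by simp
  qed (use bounds unit_height_table(11-13) unit_height_table_alt(3) in simp_all)
qed

text \<open>Both heights equal side times distance of the parallel lines, which is
  \<open>2 * S\<close> for \<open>r = 1\<close>; \<open>2 * (\<phi> + 1) * S\<close> is that
  distance divided by the side.\<close>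

lemma edge_pair_integral_opposite:
  "edge_pair_integral (j + 5) j = ennreal (r ^ 5 * (4 * S\<^sup>2 * (\<phi> - 1) *
    (2 * (parallel_primitive (2 * (\<phi> + 1) * S) 1 - parallel_primitive (2 * (\<phi> + 1) * S) 0))))"
proof -
  define \<delta> where "\<delta> = 2 * (\<phi> + 1) * S"
  have \<delta>: "0 < \<delta>" using S_pos phi_gt_1 by (simp add: \<delta>_def)
  let ?D = "\<lambda>t s. sqrt ((t - s)\<^sup>2 + \<delta>\<^sup>2)"
  \<comment> \<open>Opposite sides are traversed in opposite directions, hence
    \<open>1 - s\<close>.\<close>
  have d: "dist (edge j t) (edge (j + 5) s) = r * ((\<phi> - 1) * ?D t (1 - s))" for t s
  proof -
    have one: "1 = Complex 1 0" "unit_vertex 5 = Complex (- 1) 0"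
      by (simp_all add: unit_vertex_table complex_eq_iff)
    have "(cmod (of_real (1 - t) * unit_vertex 0 + of_real t * unit_vertex 1
        - of_real (1 - s) * unit_vertex 5 - of_real s * unit_vertex 6))\<^sup>2
      = (\<phi> - 1)\<^sup>2 * ((t - (1 - s))\<^sup>2 + \<delta>\<^sup>2)"
      unfolding one(2) unit_vertex_table one(1) \<delta>_def cmod_power2
      by (simp add: power2_eq_square golden_simps add_divide_distrib diff_divide_distrib)
    then have "cmod (of_real (1 - t) * unit_vertex 0 + of_real t * unit_vertex 1
        - of_real (1 - s) * unit_vertex 5 - of_real s * unit_vertex (Suc 5))
      = sqrt ((\<phi> - 1)\<^sup>2 * ((t - (1 - s))\<^sup>2 + \<delta>\<^sup>2))"
      by (simp add: real_sqrt_unique)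
    also have "\<dots> = (\<phi> - 1) * ?D t (1 - s)"
      using phi_gt_1 by (subst real_sqrt_mult) simp
    finally show ?thesis unfolding dist_edge_rotate by simp
  qed
  have h: "height (j + 5) (edge j t) = r\<^sup>2 * (2 * S)" "height j (edge (j + 5) s) = r\<^sup>2 * (2 * S)" for t s
    unfolding height_edge_rotate using unit_height_table unit_height_table_alt by (simp_all add: algebra_simps)
  define C where "C = r ^ 5 * (4 * S\<^sup>2 * (\<phi> - 1))"
  have C: "0 \<le> C" using r_pos phi_gt_1 by (simp add: C_def)
  have "height (j + 5) (edge j t) * height j (edge (j + 5) s) * dist (edge j t) (edge (j + 5) s) = C * ?D t (1 - s)" for t s
    unfolding h d C_def by (simp add: eval_nat_numeral)
  then have "edge_pair_integral (j + 5) j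
    = (\<integral>\<^sup>+t\<in>{0..1}. (\<integral>\<^sup>+s\<in>{0..1}. ennreal (C * ?D t (1 - s)) \<partial>lborel) \<partial>lborel)"
    unfolding edge_pair_integral_def by simp
  also have "\<dots> = (\<integral>\<^sup>+t\<in>{0..1}. (\<integral>\<^sup>+s\<in>{0..1}. ennreal (C * ?D t s) \<partial>lborel) \<partial>lborel)"
    using nn_integral_unit_shift(2)[of "\<lambda>s. ennreal (C * ?D t s)" 0 for t] by simp
  also have "\<dots> = ennreal C * (\<integral>\<^sup>+t\<in>{0..1}. (\<integral>\<^sup>+s\<in>{0..1}. ennreal (?D t s) \<partial>lborel) \<partial>lborel)"
    by (simp add: ennreal_mult'[OF C] mult.assoc nn_integral_cmult)
  also have "\<dots> = ennreal (C * (2 * (parallel_primitive \<delta> 1 - parallel_primitive \<delta> 0)))"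
    unfolding nn_integral_parallel_square[OF \<delta>] by (rule ennreal_mult'[OF C, symmetric])
  finally show ?thesis unfolding \<delta>_def C_def by (simp only: mult.assoc)
qed

text \<open>\<^term>\<open>pair_value k\<close> is the contribution, for \<open>r = 1\<close>, of two edges that are \<open>k\<close> steps apart. For \<open>1 \<le> k < 5\<close>
  the supporting lines meet at distance \<open>a\<close> side lengths from both edges, where
  \<open>a = 0, \<phi> - 1, \<phi>, 2 * \<phi> + 1\<close>.\<close>

definition pair_value :: "nat \<Rightarrow> real" where
  "pair_value k = [0,
    (2 - \<phi>)\<^sup>2 * (\<phi> - 1) * S\<^sup>2 * leg_value (\<phi> / 2) 0,
    (2 - \<phi>)\<^sup>2 * (\<phi> - 1) * (\<phi> * S)\<^sup>2 * leg_value ((\<phi> - 1) / 2) (\<phi> - 1),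
    (2 - \<phi>)\<^sup>2 * (\<phi> - 1) * (\<phi> * S)\<^sup>2 * leg_value ((1 - \<phi>) / 2) \<phi>,
    (2 - \<phi>)\<^sup>2 * (\<phi> - 1) * S\<^sup>2 * leg_value (- \<phi> / 2) (2 * \<phi> + 1),
    4 * S\<^sup>2 * (\<phi> - 1) * (2 * (parallel_primitive (2 * (\<phi> + 1) * S) 1 - parallel_primitive (2 * (\<phi> + 1) * S) 0))] ! k"

lemma less_6_cases: "k < 6 \<Longrightarrow> k = 0 \<or> k = 1 \<or> k = 2 \<or> k = 3 \<or> k = 4 \<or> k = (5::nat)"
  by auto

lemma edge_pair_integral_add:
  assumes "k < 6"
  shows "edge_pair_integral (j + k) j = ennreal (r ^ 5 * pair_value k)"
  using less_6_cases[OF assms] edge_pair_integral_legs[of j] edge_pair_integral_opposite[of j] edge_pair_integral_self[of j]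
  by (elim disjE) (simp_all add: pair_value_def del: One_nat_def)

lemma pair_value_nonneg:
  assumes "k < 6"
  shows "0 \<le> pair_value k"
proof -
  have "0 \<le> leg_value (\<phi> / 2) 0" "0 \<le> leg_value ((\<phi> - 1) / 2) (\<phi> - 1)"
    "0 \<le> leg_value ((1 - \<phi>) / 2) \<phi>" "0 \<le> leg_value (- \<phi> / 2) (2 * \<phi> + 1)"
    using phi_gt_1 phi_less_2 by (auto intro!: leg_value_nonneg)
  moreover have "parallel_primitive (2 * (\<phi> + 1) * S) 0 \<le> parallel_primitive (2 * (\<phi> + 1) * S) 1"
    using S_pos phi_gt_1 by (intro parallel_primitive_mono) simp
  ultimately show ?thesis
    using less_6_cases[OF assms] phi_gt_1 by (elim disjE) (simp_all add: pair_value_def)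
qed

text \<open>With truncated subtraction \<open>(i - j) + (j - i)\<close> is the absolute
  difference.\<close>

definition cyclic_distance :: "nat \<Rightarrow> nat \<Rightarrow> nat" where
  "cyclic_distance i j = (let d = (i - j) + (j - i) in if d \<le> 5 then d else 10 - d)"

lemma edge_pair_integral_value:
  assumes "i < 10" "j < 10"
  shows "edge_pair_integral i j = ennreal (r ^ 5 * pair_value (cyclic_distance i j))"
proof -
  have le: "edge_pair_integral i j = ennreal (r ^ 5 * pair_value (cyclic_distance i j))" if "j \<le> i" "i < 10" for i j
  proof (cases "i - j \<le> 5")
    case True
    then show ?thesis using edge_pair_integral_add[of "i - j" j] that by (simp add: cyclic_distance_def)
  next
    case False
    \<comment> \<open>More than five steps one way is fewer than five the other way, so edge
      \<open>j\<close> is reached by going on from \<open>i\<close> past the wrap-around.\<close>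
    then have "edge_pair_integral (i + (10 - (i - j))) i = ennreal (r ^ 5 * pair_value (10 - (i - j)))"
      by (intro edge_pair_integral_add) simp
    also have "i + (10 - (i - j)) = j + 10" using that by simp
    also have "edge_pair_integral (j + 10) i = edge_pair_integral i j"
      using edge_pair_integral_cong[of "j + 10" j i] by (simp add: edge_pair_integral_commute)
    finally show ?thesis using False that by (simp add: cyclic_distance_def)
  qed
  have sym: "cyclic_distance i j = cyclic_distance j i" by (simp add: cyclic_distance_def add.commute)
  show ?thesis
    using le[of j i] le[of i j] assms edge_pair_integral_commute[of i j] sym by (cases "j \<le> i") auto
qed

text \<open>The centre is the midpoint of the opposite vertices 0 and 5, hence in the hull, and it
  has positive height over every edge.\<close>

lemma regular_decagon_eq_region: "regular_polygon 10 r = region"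
proof -
  have V: "(\<lambda>k. of_real r * cis (2 * pi * real k / real 10)) = vertex"
    by (simp add: vertex_def[abs_def] unit_vertex_def)
  have "vertex 5 = - vertex 0" by (simp add: vertex_def unit_vertex_table)
  then have "0 = (1 / 2) *\<^sub>R vertex 0 + (1 / 2) *\<^sub>R vertex 5" by simp
  moreover have "(1 / 2) *\<^sub>R vertex 0 + (1 / 2) *\<^sub>R vertex 5 \<in> convex hull (vertex ` {..<10})"
    by (intro convexD[OF convex_convex_hull] hull_inc) auto
  ultimately have "0 \<in> convex hull (vertex ` {..<10})" by simp
  then show ?thesis
    unfolding regular_polygon_def V by (intro region_eq_convex_hull[symmetric, of 0]) (use height_center_pos in auto)
qed

text \<open>Each edge has two partners at each cyclic distance from 1 to 4 and one at distance
  5.\<close>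

lemma mean_distance_decagon:
  "mean_distance (regular_polygon 10 r)
    = r * (2 * (pair_value 1 + pair_value 2 + pair_value 3 + pair_value 4) + pair_value 5) / (30 * S\<^sup>2)"
proof -
  have "mean_distance region = (\<Sum>j<10. \<Sum>i<10. r ^ 5 * pair_value (cyclic_distance i j)) / (3 * (\<Sum>i<10. height i 0)\<^sup>2)"
  proof (rule mean_distance_region)
    show "0 < height i 0" for i by (rule height_center_pos)
    fix i j :: nat assume ij: "i < 10" "j < 10"
    then show "(\<integral>\<^sup>+t\<in>{0..1}. (\<integral>\<^sup>+s\<in>{0..1}. ennreal (height i (edge j t) * height j (edge i s) * dist (edge j t) (edge i s)) \<partial>lborel) \<partial>lborel)
      = ennreal (r ^ 5 * pair_value (cyclic_distance i j))"
      using edge_pair_integral_value unfolding edge_pair_integral_def by simp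
    have "cyclic_distance i j < 6" by (auto simp: cyclic_distance_def Let_def)
    then show "0 \<le> r ^ 5 * pair_value (cyclic_distance i j)"
      using r_pos pair_value_nonneg by simp
  qed
  also have "(\<Sum>i<10. height i 0) = 10 * (r\<^sup>2 * S)" by (simp add: height_center)
  also have "(\<Sum>j<10. \<Sum>i<10. r ^ 5 * pair_value (cyclic_distance i j))
    = r ^ 5 * (\<Sum>j<10. \<Sum>i<10. pair_value (cyclic_distance i j))"
    by (simp add: sum_distrib_left)
  also have "(\<Sum>j<10. \<Sum>i<10. pair_value (cyclic_distance i j))
    = 10 * (2 * (pair_value 1 + pair_value 2 + pair_value 3 + pair_value 4) + pair_value 5)"
  proof -
    have range: "{..<10::nat} = {0, 1, 2, 3, 4, 5, 6, 7, 8, 9}" by auto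
    have "pair_value 0 = 0" by (simp add: pair_value_def)
    then show ?thesis unfolding range by (simp add: cyclic_distance_def numeral_2_eq_2[symmetric])
  qed
  also have "r ^ 5 * (10 * X) / (3 * (10 * (r\<^sup>2 * S))\<^sup>2) = r * X / (30 * S\<^sup>2)" for X
    using r_pos by (simp add: eval_nat_numeral)
  finally show ?thesis unfolding regular_decagon_eq_region .
qed

end

section \<open>Closed forms\<close>

text \<open>Splits an evaluation into independent identities for the root, the algebraic part, the
  coefficient and the logarithm. The root \<open>D\<close> is proposed and then verified by
  squaring.\<close>

lemma leg_primitive_eq:
  assumes "0 \<le> D" "D * D = w * w + 2 * \<kappa> * w + 1"
    and "D * D * D / 3 - \<kappa> * ((w + \<kappa>) * D) / 2 = u"
    and "\<kappa> * (1 - \<kappa> * \<kappa>) / 2 = c"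
    and "ln (w + \<kappa> + D) = l"
  shows "leg_primitive \<kappa> w = u - c * l"
proof -
  have "leg_dist \<kappa> w = D"
    unfolding leg_dist_def by (rule real_sqrt_unique) (use assms(1,2) in \<open>simp_all add: power2_eq_square\<close>)
  then have "leg_primitive \<kappa> w = (D * D * D / 3 - \<kappa> * ((w + \<kappa>) * D) / 2) - \<kappa> * (1 - \<kappa> * \<kappa>) / 2 * ln (w + \<kappa> + D)"
    by (simp add: leg_primitive_def power2_eq_square power3_eq_cube algebra_simps add_divide_distrib diff_divide_distrib)
  then show ?thesis unfolding assms(3-5) .
qed

section \<open>Evaluation of the primitives\<close>

context golden_ratio
begin

text \<open>Up to rational powers of \<open>2\<close>, \<open>\<phi>\<close> and \<open>sqrt 5 = 2 * \<phi> - 1\<close>, all arguments of logarithms reduce to these two numbers.\<close>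

definition X1 :: real where "X1 = 2 * \<phi> - 1 + 4 * (\<phi> * S)"
definition X2 :: real where "X2 = 2 * \<phi> - 1 + 4 * S"

lemma X_pos: "0 < X1" "0 < X2"
proof -
  have "0 < \<phi> * S" using S_pos phi_gt_1 by simp
  then show "0 < X1" "0 < X2" using S_pos phi_gt_1 unfolding X1_def X2_def by linarith+
qed

lemma ln_sqrt_5: "ln (2 * \<phi> - 1) = ln 5 / 2"
  using ln_sqrt[of 5] by (simp add: sqrt_5_eq)

text \<open>Rests on \<open>S * S = sqrt 5 / (4 * \<phi>)\<close>, with
  \<open>2 * \<phi> - 1\<close> in place of \<open>sqrt 5\<close>.\<close>

lemma ln_S: "ln S = ln 5 / 4 - ln \<phi> / 2 - ln 2"
proof -
  have "S * S = (2 * \<phi> - 1) / (2 * (2 * \<phi>))"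
    using phi_gt_1 by (simp add: field_simps) (simp add: golden_simps)
  then have "ln S + ln S = ln ((2 * \<phi> - 1) / (2 * (2 * \<phi>)))"
    using S_pos by (metis ln_mult_pos)
  also have "\<dots> = ln (2 * \<phi> - 1) - ln (2 * (2 * \<phi>))"
    by (rule ln_divide_pos) (use phi_gt_1 in simp_all)
  also have "ln (2 * (2 * \<phi>)) = ln 2 + ln (2 * \<phi>)"
    by (rule ln_mult_pos) (use phi_gt_1 in simp_all)
  also have "ln (2 * \<phi>) = ln 2 + ln \<phi>"
    by (rule ln_mult_pos) (use phi_gt_1 in simp_all)
  finally show ?thesis by (simp add: ln_sqrt_5)
qed

text \<open>Each argument is \<open>w + \<kappa> + D\<close> for one evaluation of
  \<open>leg_primitive\<close>, kept in the unsimplified shape in which it arises there.\<close>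

lemma ln_arguments:
  "ln (1 + \<phi> / 2 + 2 * \<phi> * S) = ln \<phi> + ln X2 - ln 2"
  "ln (0 + \<phi> / 2 + 1) = ln \<phi> + 1 / 2 * ln 5 - ln 2"
  "ln (1 + (\<phi> - 1) / 2 + \<phi>) = 2 * ln \<phi> + 1 / 2 * ln 5 - ln 2"
  "ln (2 - \<phi> + (\<phi> - 1) / 2 + 2 * S) = ln X1 - ln \<phi> - ln 2"
  "ln (\<phi> + 1 + (\<phi> - 1) / 2 + (2 * S + 2 * \<phi> * S)) = 2 * ln \<phi> + ln X2 - ln 2"
  "ln (1 + (1 - \<phi>) / 2 + 2 * S) = ln X1 - ln \<phi> - ln 2"
  "ln (\<phi> - 1 + (1 - \<phi>) / 2 + 1) = 2 * ln \<phi> - ln 2"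
  "ln (\<phi> + (1 - \<phi>) / 2 + \<phi>) = 2 * ln \<phi> + 1 / 2 * ln 5 - ln 2"
  "ln (1 + (- \<phi> / 2) + (- 1 + \<phi>)) = ln \<phi> - ln 2"
  "ln (\<phi> / 2 + (- \<phi> / 2) + S) = 1 / 4 * ln 5 - 1 / 2 * ln \<phi> - ln 2"
  "ln (2 * \<phi> - 2 + (- \<phi> / 2) + (- 2 * S + 2 * \<phi> * S)) = ln X1 - 2 * ln \<phi> - ln 2"
proof -
  have prod_rules:
    "ln (\<phi> * X2 / 2) = ln \<phi> + ln X2 - ln 2"
    "ln ((2 * \<phi> - 1) * \<phi> / 2) = ln 5 / 2 + ln \<phi> - ln 2"
    "ln ((2 * \<phi> - 1) * (\<phi> * \<phi>) / 2) = ln 5 / 2 + 2 * ln \<phi> - ln 2"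
    "ln (X1 / (2 * \<phi>)) = ln X1 - (ln 2 + ln \<phi>)"
    "ln (\<phi> * \<phi> * X2 / 2) = 2 * ln \<phi> + ln X2 - ln 2"
    "ln (\<phi> * \<phi> / 2) = 2 * ln \<phi> - ln 2"
    "ln (\<phi> / 2) = ln \<phi> - ln 2"
    "ln (X1 / (2 * (\<phi> * \<phi>))) = ln X1 - (ln 2 + 2 * ln \<phi>)"
    using phi_gt_1 X_pos by (simp_all add: ln_div ln_mult ln_sqrt_5)
  have "1 + \<phi> / 2 + 2 * \<phi> * S = \<phi> * X2 / 2"
    using phi_gt_1 by (simp add: X1_def X2_def field_simps) (simp add: golden_simps)?
  then show "ln (1 + \<phi> / 2 + 2 * \<phi> * S) = ln \<phi> + ln X2 - ln 2" by (simp only: prod_rules; simp)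
  have "0 + \<phi> / 2 + 1 = (2 * \<phi> - 1) * \<phi> / 2"
    using phi_gt_1 by (simp add: X1_def X2_def field_simps) (simp add: golden_simps)?
  then show "ln (0 + \<phi> / 2 + 1) = ln \<phi> + 1 / 2 * ln 5 - ln 2" by (simp only: prod_rules; simp)
  have "1 + (\<phi> - 1) / 2 + \<phi> = (2 * \<phi> - 1) * (\<phi> * \<phi>) / 2"
    using phi_gt_1 by (simp add: X1_def X2_def field_simps) (simp add: golden_simps)?
  then show "ln (1 + (\<phi> - 1) / 2 + \<phi>) = 2 * ln \<phi> + 1 / 2 * ln 5 - ln 2" by (simp only: prod_rules; simp)
  have "2 - \<phi> + (\<phi> - 1) / 2 + 2 * S = X1 / (2 * \<phi>)"
    using phi_gt_1 by (simp add: X1_def X2_def field_simps) (simp add: golden_simps)?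
  then show "ln (2 - \<phi> + (\<phi> - 1) / 2 + 2 * S) = ln X1 - ln \<phi> - ln 2" by (simp only: prod_rules; simp)
  have "\<phi> + 1 + (\<phi> - 1) / 2 + (2 * S + 2 * \<phi> * S) = \<phi> * \<phi> * X2 / 2"
    using phi_gt_1 by (simp add: X1_def X2_def field_simps) (simp add: golden_simps)?
  then show "ln (\<phi> + 1 + (\<phi> - 1) / 2 + (2 * S + 2 * \<phi> * S)) = 2 * ln \<phi> + ln X2 - ln 2" by (simp only: prod_rules; simp)
  have "1 + (1 - \<phi>) / 2 + 2 * S = X1 / (2 * \<phi>)"
    using phi_gt_1 by (simp add: X1_def X2_def field_simps) (simp add: golden_simps)?
  then show "ln (1 + (1 - \<phi>) / 2 + 2 * S) = ln X1 - ln \<phi> - ln 2" by (simp only: prod_rules; simp)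
  have "\<phi> - 1 + (1 - \<phi>) / 2 + 1 = \<phi> * \<phi> / 2"
    using phi_gt_1 by (simp add: X1_def X2_def field_simps) (simp add: golden_simps)?
  then show "ln (\<phi> - 1 + (1 - \<phi>) / 2 + 1) = 2 * ln \<phi> - ln 2" by (simp only: prod_rules; simp)
  have "\<phi> + (1 - \<phi>) / 2 + \<phi> = (2 * \<phi> - 1) * (\<phi> * \<phi>) / 2"
    using phi_gt_1 by (simp add: X1_def X2_def field_simps) (simp add: golden_simps)?
  then show "ln (\<phi> + (1 - \<phi>) / 2 + \<phi>) = 2 * ln \<phi> + 1 / 2 * ln 5 - ln 2" by (simp only: prod_rules; simp)
  have "1 + (- \<phi> / 2) + (- 1 + \<phi>) = \<phi> / 2"
    using phi_gt_1 by (simp add: X1_def X2_def field_simps) (simp add: golden_simps)?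
  then show "ln (1 + (- \<phi> / 2) + (- 1 + \<phi>)) = ln \<phi> - ln 2" by (simp only: prod_rules; simp)
  show "ln (\<phi> / 2 + (- \<phi> / 2) + S) = 1 / 4 * ln 5 - 1 / 2 * ln \<phi> - ln 2" by (simp add: ln_S)
  have "2 * \<phi> - 2 + (- \<phi> / 2) + (- 2 * S + 2 * \<phi> * S) = X1 / (2 * (\<phi> * \<phi>))"
    using phi_gt_1 by (simp add: X1_def X2_def field_simps) (simp add: golden_simps)?
  then show "ln (2 * \<phi> - 2 + (- \<phi> / 2) + (- 2 * S + 2 * \<phi> * S)) = ln X1 - 2 * ln \<phi> - ln 2" by (simp only: prod_rules; simp)
qed

text \<open>For legs \<open>p\<close> and \<open>p * w\<close> that end at vertices,
  \<open>p * D\<close> is the distance of these vertices in side lengths. This is where the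
  witnesses \<open>D\<close> come from and why they lie in the field.\<close>

lemma leg_primitive_values:
  "leg_primitive (\<phi> / 2) 1 = - 1 / 12 * S + \<phi> * S - (- 1 / 16 + 1 / 8 * \<phi>) * (ln \<phi> + ln X2 - ln 2)"
  "leg_primitive (\<phi> / 2) 0 = 5 / 24 - 1 / 8 * \<phi> - (- 1 / 16 + 1 / 8 * \<phi>) * (ln \<phi> + 1 / 2 * ln 5 - ln 2)"
  "leg_primitive ((\<phi> - 1) / 2) 1 = 5 / 24 + 13 / 24 * \<phi> - (- 1 / 16 + 1 / 8 * \<phi>) * (2 * ln \<phi> + 1 / 2 * ln 5 - ln 2)"
  "leg_primitive ((\<phi> - 1) / 2) (2 - \<phi>) = 3 * S - 17 / 12 * \<phi> * S - (- 1 / 16 + 1 / 8 * \<phi>) * (ln X1 - ln \<phi> - ln 2)"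
  "leg_primitive ((\<phi> - 1) / 2) (\<phi> + 1) = 47 / 12 * S + 19 / 3 * \<phi> * S - (- 1 / 16 + 1 / 8 * \<phi>) * (2 * ln \<phi> + ln X2 - ln 2)"
  "leg_primitive ((1 - \<phi>) / 2) 1 = S + 1 / 12 * \<phi> * S - (1 / 16 - 1 / 8 * \<phi>) * (ln X1 - ln \<phi> - ln 2)"
  "leg_primitive ((1 - \<phi>) / 2) (\<phi> - 1) = 7 / 12 - 1 / 8 * \<phi> - (1 / 16 - 1 / 8 * \<phi>) * (2 * ln \<phi> - ln 2)"
  "leg_primitive ((1 - \<phi>) / 2) \<phi> = 11 / 24 + 19 / 24 * \<phi> - (1 / 16 - 1 / 8 * \<phi>) * (2 * ln \<phi> + 1 / 2 * ln 5 - ln 2)"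
  "leg_primitive (- \<phi> / 2) 1 = - 3 / 4 + 13 / 24 * \<phi> - (1 / 16 - 1 / 8 * \<phi>) * (ln \<phi> - ln 2)"
  "leg_primitive (- \<phi> / 2) (\<phi> / 2) = 1 / 4 * S - 1 / 12 * \<phi> * S - (1 / 16 - 1 / 8 * \<phi>) * (1 / 4 * ln 5 - 1 / 2 * ln \<phi> - ln 2)"
  "leg_primitive (- \<phi> / 2) (2 * \<phi> - 2) = - 25 / 3 * S + 65 / 12 * \<phi> * S - (1 / 16 - 1 / 8 * \<phi>) * (ln X1 - 2 * ln \<phi> - ln 2)"
proof -
  have "0 \<le> (\<phi> - 1) * S" using phi_gt_1 S_pos by simp
  then have nonneg: "0 \<le> - 2 * S + 2 * (\<phi> * S)" "0 \<le> \<phi> * S" "0 \<le> S" "0 \<le> \<phi>" "0 \<le> - 1 + \<phi>"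
    using phi_gt_1 S_pos by (simp_all add: algebra_simps)
  show "leg_primitive (\<phi> / 2) 1 = - 1 / 12 * S + \<phi> * S - (- 1 / 16 + 1 / 8 * \<phi>) * (ln \<phi> + ln X2 - ln 2)"
    by (rule leg_primitive_eq[where D = "2 * \<phi> * S"]) (use nonneg in \<open>simp_all only: ln_arguments\<close>,
      simp_all add: golden_simps add_divide_distrib diff_divide_distrib)
  show "leg_primitive (\<phi> / 2) 0 = 5 / 24 - 1 / 8 * \<phi> - (- 1 / 16 + 1 / 8 * \<phi>) * (ln \<phi> + 1 / 2 * ln 5 - ln 2)"
    by (rule leg_primitive_eq[where D = "1"]) (use nonneg in \<open>simp_all only: ln_arguments\<close>,
      simp_all add: golden_simps add_divide_distrib diff_divide_distrib)
  show "leg_primitive ((\<phi> - 1) / 2) 1 = 5 / 24 + 13 / 24 * \<phi> - (- 1 / 16 + 1 / 8 * \<phi>) * (2 * ln \<phi> + 1 / 2 * ln 5 - ln 2)"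
    by (rule leg_primitive_eq[where D = "\<phi>"]) (use nonneg in \<open>simp_all only: ln_arguments\<close>,
      simp_all add: golden_simps add_divide_distrib diff_divide_distrib)
  show "leg_primitive ((\<phi> - 1) / 2) (2 - \<phi>) = 3 * S - 17 / 12 * \<phi> * S - (- 1 / 16 + 1 / 8 * \<phi>) * (ln X1 - ln \<phi> - ln 2)"
    by (rule leg_primitive_eq[where D = "2 * S"]) (use nonneg in \<open>simp_all only: ln_arguments\<close>,
      simp_all add: golden_simps add_divide_distrib diff_divide_distrib)
  show "leg_primitive ((\<phi> - 1) / 2) (\<phi> + 1) = 47 / 12 * S + 19 / 3 * \<phi> * S - (- 1 / 16 + 1 / 8 * \<phi>) * (2 * ln \<phi> + ln X2 - ln 2)"
    by (rule leg_primitive_eq[where D = "2 * S + 2 * \<phi> * S"]) (use nonneg in \<open>simp_all only: ln_arguments\<close>,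
      simp_all add: golden_simps add_divide_distrib diff_divide_distrib)
  show "leg_primitive ((1 - \<phi>) / 2) 1 = S + 1 / 12 * \<phi> * S - (1 / 16 - 1 / 8 * \<phi>) * (ln X1 - ln \<phi> - ln 2)"
    by (rule leg_primitive_eq[where D = "2 * S"]) (use nonneg in \<open>simp_all only: ln_arguments\<close>,
      simp_all add: golden_simps add_divide_distrib diff_divide_distrib)
  show "leg_primitive ((1 - \<phi>) / 2) (\<phi> - 1) = 7 / 12 - 1 / 8 * \<phi> - (1 / 16 - 1 / 8 * \<phi>) * (2 * ln \<phi> - ln 2)"
    by (rule leg_primitive_eq[where D = "1"]) (use nonneg in \<open>simp_all only: ln_arguments\<close>,
      simp_all add: golden_simps add_divide_distrib diff_divide_distrib)
  show "leg_primitive ((1 - \<phi>) / 2) \<phi> = 11 / 24 + 19 / 24 * \<phi> - (1 / 16 - 1 / 8 * \<phi>) * (2 * ln \<phi> + 1 / 2 * ln 5 - ln 2)"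
    by (rule leg_primitive_eq[where D = "\<phi>"]) (use nonneg in \<open>simp_all only: ln_arguments\<close>,
      simp_all add: golden_simps add_divide_distrib diff_divide_distrib)
  show "leg_primitive (- \<phi> / 2) 1 = - 3 / 4 + 13 / 24 * \<phi> - (1 / 16 - 1 / 8 * \<phi>) * (ln \<phi> - ln 2)"
    by (rule leg_primitive_eq[where D = "- 1 + \<phi>"]) (use nonneg in \<open>simp_all only: ln_arguments\<close>,
      simp_all add: golden_simps add_divide_distrib diff_divide_distrib)
  show "leg_primitive (- \<phi> / 2) (\<phi> / 2) = 1 / 4 * S - 1 / 12 * \<phi> * S - (1 / 16 - 1 / 8 * \<phi>) * (1 / 4 * ln 5 - 1 / 2 * ln \<phi> - ln 2)"
    by (rule leg_primitive_eq[where D = "S"]) (use nonneg in \<open>simp_all only: ln_arguments\<close>,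
      simp_all add: golden_simps add_divide_distrib diff_divide_distrib)
  show "leg_primitive (- \<phi> / 2) (2 * \<phi> - 2) = - 25 / 3 * S + 65 / 12 * \<phi> * S - (1 / 16 - 1 / 8 * \<phi>) * (ln X1 - 2 * ln \<phi> - ln 2)"
    by (rule leg_primitive_eq[where D = "- 2 * S + 2 * \<phi> * S"]) (use nonneg in \<open>simp_all only: ln_arguments\<close>,
      simp_all add: golden_simps add_divide_distrib diff_divide_distrib)
qed

lemma leg_values:
  "leg_value (\<phi> / 2) 0 = - 1 / 12 + 1 / 20 * \<phi> - 1 / 30 * S + 2 / 5 * \<phi> * S - (1 / 80 - 1 / 40 * \<phi>) * ln 5 + (1 / 40 - 1 / 20 * \<phi>) * ln X2"
  "leg_value ((\<phi> - 1) / 2) (\<phi> - 1) = 7 / 4 + 23 / 12 * \<phi> - 9 / 10 * S - 17 / 10 * \<phi> * S - (21 / 40 + 33 / 40 * \<phi>) * ln \<phi> - 5 / 16 * ln 5 + (7 / 40 + 11 / 40 * \<phi>) * ln X1 + (9 / 20 - 11 / 40 * \<phi>) * ln X2"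
  "leg_value ((1 - \<phi>) / 2) \<phi> = - 439 / 60 - 71 / 6 * \<phi> + 84 / 5 * S + 817 / 30 * \<phi> * S - (249 / 40 + 201 / 20 * \<phi>) * ln \<phi> - (7 / 80 + 11 / 80 * \<phi>) * ln 5 + (83 / 40 + 67 / 20 * \<phi>) * ln X1"
  "leg_value (- \<phi> / 2) (2 * \<phi> + 1) = 74 + 1439 / 12 * \<phi> - 1727 / 15 * S - 5587 / 30 * \<phi> * S + (6177 / 40 + 2499 / 10 * \<phi>) * ln \<phi> - (76 / 5 + 123 / 5 * \<phi>) * ln 5 - (843 / 40 + 341 / 10 * \<phi>) * ln X1"
proof -
  have pow5: "x ^ 5 = x * x * (x * x) * x" for x :: real by (simp add: eval_nat_numeral)
  show "leg_value (\<phi> / 2) 0 = - 1 / 12 + 1 / 20 * \<phi> - 1 / 30 * S + 2 / 5 * \<phi> * S - (1 / 80 - 1 / 40 * \<phi>) * ln 5 + (1 / 40 - 1 / 20 * \<phi>) * ln X2"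
    by (simp add: leg_value_def leg_primitive_values[unfolded One_nat_def] golden_simps add_divide_distrib diff_divide_distrib)
  \<comment> \<open>In this case and the next two, \<open>a\<close> and \<open>a + 1\<close> are
    powers of \<open>\<phi>\<close>, once with a factor 2 (\<open>\<phi> - 1\<close> is the inverse
    of \<open>\<phi>\<close>). Hence the Fibonacci numbers in the fifth powers.\<close>
  have "(\<phi> - 1 + 1) ^ 5 = 5 * \<phi> + 3" "(\<phi> - 1) ^ 5 = 5 * \<phi> - 8"
    "(\<phi> - 1) / (\<phi> - 1 + 1) = 2 - \<phi>" "(\<phi> - 1 + 1) / (\<phi> - 1) = \<phi> + 1"
    using phi_gt_1 unfolding pow5 by (simp_all add: field_simps) (simp_all add: golden_simps)
  then show "leg_value ((\<phi> - 1) / 2) (\<phi> - 1) = 7 / 4 + 23 / 12 * \<phi> - 9 / 10 * S - 17 / 10 * \<phi> * S - (21 / 40 + 33 / 40 * \<phi>) * ln \<phi> - 5 / 16 * ln 5 + (7 / 40 + 11 / 40 * \<phi>) * ln X1 + (9 / 20 - 11 / 40 * \<phi>) * ln X2"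
    by (simp only: leg_value_def leg_primitive_values) (simp add: golden_simps add_divide_distrib diff_divide_distrib)
  have "(\<phi> + 1) ^ 5 = 55 * \<phi> + 34" "(\<phi>) ^ 5 = 5 * \<phi> + 3"
    "(\<phi>) / (\<phi> + 1) = \<phi> - 1" "(\<phi> + 1) / (\<phi>) = \<phi>"
    using phi_gt_1 unfolding pow5 by (simp_all add: field_simps) (simp_all add: golden_simps)
  then show "leg_value ((1 - \<phi>) / 2) \<phi> = - 439 / 60 - 71 / 6 * \<phi> + 84 / 5 * S + 817 / 30 * \<phi> * S - (249 / 40 + 201 / 20 * \<phi>) * ln \<phi> - (7 / 80 + 11 / 80 * \<phi>) * ln 5 + (83 / 40 + 67 / 20 * \<phi>) * ln X1"
    by (simp only: leg_value_def leg_primitive_values) (simp add: golden_simps add_divide_distrib diff_divide_distrib)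
  have "(2 * \<phi> + 1 + 1) ^ 5 = 1760 * \<phi> + 1088" "(2 * \<phi> + 1) ^ 5 = 610 * \<phi> + 377"
    "(2 * \<phi> + 1) / (2 * \<phi> + 1 + 1) = \<phi> / 2" "(2 * \<phi> + 1 + 1) / (2 * \<phi> + 1) = 2 * \<phi> - 2"
    using phi_gt_1 unfolding pow5 by (simp_all add: field_simps) (simp_all add: golden_simps)
  then show "leg_value (- \<phi> / 2) (2 * \<phi> + 1) = 74 + 1439 / 12 * \<phi> - 1727 / 15 * S - 5587 / 30 * \<phi> * S + (6177 / 40 + 2499 / 10 * \<phi>) * ln \<phi> - (76 / 5 + 123 / 5 * \<phi>) * ln 5 - (843 / 40 + 341 / 10 * \<phi>) * ln X1"
    by (simp only: leg_value_def leg_primitive_values) (simp add: golden_simps add_divide_distrib diff_divide_distrib)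
qed

text \<open>The ratio \<open>\<delta>\<close> is such that
  \<open>1 + \<delta>\<^sup>2 = (2 * \<phi>)\<^sup>2\<close>, and the arguments of both logarithms
  factor: \<open>1 + 2 * \<phi> = \<phi> ^ 3\<close> and
  \<open>\<delta> = 2 * \<phi>\<^sup>2 * S\<close>.\<close>

lemma parallel_primitive_value:
  "2 * (parallel_primitive (2 * (\<phi> + 1) * S) 1 - parallel_primitive (2 * (\<phi> + 1) * S) 0)
    = - 16 / 3 - 26 / 3 * \<phi> + 28 / 3 * S + 44 / 3 * \<phi> * S + (9 / 2 + 6 * \<phi>) * ln \<phi> - (3 / 4 + \<phi>) * ln 5"
proof -
  define \<delta> where "\<delta> = 2 * (\<phi> + 1) * S"
  have \<delta>: "0 < \<delta>" using S_pos phi_gt_1 by (simp add: \<delta>_def)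
  have \<delta>2: "\<delta>\<^sup>2 = 4 * \<phi> + 3"
    by (simp add: \<delta>_def power2_eq_square golden_simps add_divide_distrib diff_divide_distrib)
  have s1: "sqrt (1 + \<delta>\<^sup>2) = 2 * \<phi>"
    by (rule real_sqrt_unique) (use phi_gt_1 in \<open>simp_all add: \<delta>2 \<delta>2[unfolded power2_eq_square] power2_eq_square golden_simps\<close>)
  have "1 + 2 * \<phi> = \<phi> * \<phi> * \<phi>" by (simp add: golden_simps)
  then have l1: "ln (1 + 2 * \<phi>) = 3 * ln \<phi>"
    using phi_gt_1 by (simp add: ln_mult)
  have "\<delta> = 2 * (\<phi> * \<phi>) * S" by (simp add: \<delta>_def phi_sq)
  then have l0: "ln \<delta> = 3 / 2 * ln \<phi> + ln 5 / 4"
    using phi_gt_1 S_pos by (simp add: ln_mult ln_S)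
  have "parallel_primitive \<delta> 1 = (2 * \<phi> + (4 * \<phi> + 3) * (3 * ln \<phi>)) / 2 - (2 * \<phi>) ^ 3 / 3"
    by (simp add: parallel_primitive_def s1 \<delta>2[symmetric] l1) 
  moreover have "parallel_primitive \<delta> 0 = (4 * \<phi> + 3) * (3 / 2 * ln \<phi> + ln 5 / 4) / 2 - (4 * \<phi> + 3) * \<delta> / 3"
    using \<delta> by (simp add: parallel_primitive_def l0 \<delta>2[symmetric] power3_eq_cube power2_eq_square)
  ultimately show ?thesis
    unfolding \<delta>_def[symmetric] by (simp add: \<delta>_def power3_eq_cube golden_simps add_divide_distrib diff_divide_distrib)
qed

end

section \<open>The closed form of the mean distance\<close>

context decagon
begin

lemma pair_value_sum:
  "(2 * (pair_value 1 + pair_value 2 + pair_value 3 + pair_value 4) + pair_value 5) / (30 * S\<^sup>2)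
    = - 13 / 150 - 11 / 75 * \<phi> + 31 / 75 * S + 11 / 25 * \<phi> * S + (26 / 25 + 48 / 25 * \<phi>) * ln \<phi> - (1 / 20 + 3 / 10 * \<phi>) * ln 5 - (7 / 75 + 11 / 75 * \<phi>) * ln X1 - (47 / 300 - 29 / 300 * \<phi>) * ln X2"
proof -
  have "(2 * (pair_value 1 + pair_value 2 + pair_value 3 + pair_value 4) + pair_value 5)
    = S\<^sup>2 * (2 * ((2 - \<phi>)\<^sup>2 * (\<phi> - 1) * (leg_value (\<phi> / 2) 0
        + \<phi>\<^sup>2 * leg_value ((\<phi> - 1) / 2) (\<phi> - 1) + \<phi>\<^sup>2 * leg_value ((1 - \<phi>) / 2) \<phi>
        + leg_value (- \<phi> / 2) (2 * \<phi> + 1)))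
      + 4 * (\<phi> - 1) * (2 * (parallel_primitive (2 * (\<phi> + 1) * S) 1 - parallel_primitive (2 * (\<phi> + 1) * S) 0)))"
    by (simp add: pair_value_def power_mult_distrib algebra_simps)
  then have "(2 * (pair_value 1 + pair_value 2 + pair_value 3 + pair_value 4) + pair_value 5) / (30 * S\<^sup>2)
    = (2 * ((2 - \<phi>)\<^sup>2 * (\<phi> - 1) * (leg_value (\<phi> / 2) 0
        + \<phi>\<^sup>2 * leg_value ((\<phi> - 1) / 2) (\<phi> - 1) + \<phi>\<^sup>2 * leg_value ((1 - \<phi>) / 2) \<phi>
        + leg_value (- \<phi> / 2) (2 * \<phi> + 1)))
      + 4 * (\<phi> - 1) * (2 * (parallel_primitive (2 * (\<phi> + 1) * S) 1 - parallel_primitive (2 * (\<phi> + 1) * S) 0))) / 30"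
    using S_pos by simp
  \<comment> \<open>The fifth power of the side \<open>\<phi> - 1\<close>.\<close>
  also have "(2 - \<phi>)\<^sup>2 * (\<phi> - 1) = 5 * \<phi> - 8" by (simp add: power2_eq_square golden_simps)
  also have "\<phi>\<^sup>2 = \<phi> + 1" by (simp add: power2_eq_square phi_sq)
  finally show ?thesis
    unfolding leg_values[simplified] leg_values parallel_primitive_value by (simp add: golden_simps add_divide_distrib diff_divide_distrib)
qed

end

theorem mainTheorem6:
  fixes r :: real
  assumes "r > 0"
  shows "mean_distance (regular_polygon 10 r) / r =
    1 / 600 *
      (4 * (sqrt (5125 + 2110 * sqrt 5) - 24 - 11 * sqrt 5)
       - (505 + 239 * sqrt 5) * ln 2
       - 30 * (4 + 3 * sqrt 5) * ln 5
       - (205 + 107 * sqrt 5) * ln (1 + sqrt 5)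
       + (705 + 343 * sqrt 5) * ln (3 + sqrt 5)
       - (105 + 47 * sqrt 5) * ln (sqrt 5 + sqrt (10 + 2 * sqrt 5))
       - (65 - 29 * sqrt 5) * ln (sqrt 5 + sqrt (10 - 2 * sqrt 5))
       + (5 + 3 * sqrt 5) * ln (5 - sqrt 5 + 2 * sqrt (10 - 2 * sqrt 5)))"
proof -
  define \<phi> where "\<phi> = (1 + sqrt 5) / 2"
  define S where "S = sin (pi / 5)"
  interpret decagon \<phi> S r
    by unfold_locales (use assms in \<open>simp_all add: \<phi>_def S_def\<close>)
  have \<phi>: "0 < \<phi>" using phi_gt_1 by simp
  have phi_S: "0 < \<phi> * S" using \<phi> S_pos by simp
  \<comment> \<open>The first two roots turn logarithms of the statement into \<open>ln X1\<close>
    and \<open>ln X2\<close>. The third is the part of the result with factor \<open>S\<close>: 4 /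
    600 of it is \<open>31 / 75 * S + 11 / 25 * \<phi> * S\<close>.\<close>
  have roots: "sqrt (10 + 2 * (2 * \<phi> - 1)) = 4 * (\<phi> * S)" "sqrt (10 - 2 * (2 * \<phi> - 1)) = 4 * S"
    "sqrt (5125 + 2110 * (2 * \<phi> - 1)) = 66 * (\<phi> * S) + 62 * S"
    by (rule real_sqrt_unique;
      use phi_S S_pos in \<open>simp add: power2_eq_square golden_simps add_divide_distrib diff_divide_distrib\<close>)+
  \<comment> \<open>The other arguments are \<open>2 * \<phi>\<close>,
    \<open>2 * \<phi>\<^sup>2\<close> and \<open>2 * X1 / \<phi>\<close>, so that both sides involve
    only the logarithms of 2, 5, \<open>\<phi>\<close>, \<open>X1\<close> and
    \<open>X2\<close>.\<close>
  have ln_1: "ln (1 + (2 * \<phi> - 1)) = ln 2 + ln \<phi>"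
    using ln_mult_pos[of 2 \<phi>] \<phi> by simp
  have ln_3: "ln (3 + (2 * \<phi> - 1)) = ln 2 + 2 * ln \<phi>"
  proof -
    have "3 + (2 * \<phi> - 1) = 2 * (\<phi> * \<phi>)" by (simp add: phi_sq)
    then show ?thesis using ln_mult_pos[of 2 "\<phi> * \<phi>"] ln_mult_pos[of \<phi> \<phi>] \<phi> by simp
  qed
  have ln_5: "ln (5 - (2 * \<phi> - 1) + 2 * (4 * S)) = ln 2 + ln X1 - ln \<phi>"
  proof -
    have "(5 - (2 * \<phi> - 1) + 2 * (4 * S)) * \<phi> = 2 * X1"
      by (simp add: X1_def golden_simps)
    then have "5 - (2 * \<phi> - 1) + 2 * (4 * S) = 2 * X1 / \<phi>"
      using \<phi> by (simp add: eq_divide_eq)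
    then show ?thesis using ln_divide_pos[of "2 * X1" \<phi>] ln_mult_pos[of 2 X1] X_pos \<phi> by simp
  qed
  have "mean_distance (regular_polygon 10 r) / r
    = (2 * (pair_value 1 + pair_value 2 + pair_value 3 + pair_value 4) + pair_value 5) / (30 * S\<^sup>2)"
    using assms unfolding mean_distance_decagon by simp
  then show ?thesis
    unfolding sqrt_5_eq roots ln_1 ln_3 ln_5 X1_def[symmetric] X2_def[symmetric] pair_value_sum
    by (simp add: golden_simps add_divide_distrib diff_divide_distrib)
qed

end
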